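(* Let $\mathcal{C}$ be a complete category and $B\colon\mathcal{C}\to\mathcal{C}$ an endofunctor such that the codensity monad $\mathrm{Ran}_{\bar B}\bar B$ of its final sequence exists, $B$ preserves it, and $B_{k+1,k}\colon B_{k+1}\to B_k$ is an isomorphism for some ordinal $k$ (so $(B_k,B_{k+1,k}^{-1})$ is a final $B$-coalgebra). Let $F\colon\mathcal{C}\to\mathcal{C}$ be a functor with free monad $F^*$. Then every algebra $\alpha\colon FB_k\to B_k$ induced on the final coalgebra by an abstract GSOS specification $\lambda\colon F(B\times\mathrm{Id})\Rightarrow BF^*$ is definable by a distributive law over $B$: there exist a functor $G$, a natural transformation $\rho\colon GB\Rightarrow BG$ with induced algebra $\beta\colon GB_k\to B_k$, and a natural transformation $\kappa\colon F\Rightarrow G$ with $\alpha=\beta\circ\kappa_{B_k}$.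
   Context: Final sequence: $B_0=1$, $B_{i+1}=BB_i$, $B_j=\lim_{i<j}B_i$ at limit $j$, connecting maps $B_{j,i}$ with $B_{i,i}=\mathrm{id}$, $B_{j+1,i+1}=BB_{j,i}$; functor $\bar B\colon\mathrm{Ord}^{op}\to\mathcal{C}$. Codensity monad: right Kan extension $(\mathrm{Ran}_{\bar B}\bar B,\epsilon)$ of $\bar B$ along itself ($\epsilon\colon(\mathrm{Ran}_{\bar B}\bar B)\bar B\Rightarrow\bar B$ through which every $H\bar B\Rightarrow\bar B$ factors uniquely as $\epsilon\circ\hat\alpha\bar B$); $B$ preserves it if $(B\circ\mathrm{Ran}_{\bar B}\bar B,B\epsilon)$ is a right Kan extension of $B\bar B$ along $\bar B$. For a final coalgebra $(Z,\zeta)$, the algebra induced by an abstract GSOS $\lambda$ is the unique $\alpha\colon FZ\to Z$ with $\zeta\circ\alpha=B\alpha^*\circ\lambda_Z\circ F\langle\zeta,\mathrm{id}\rangle$, where $\alpha^*\colon F^*Z\to Z$ is the Eilenberg–Moore algebra of the free monad corresponding to $\alpha$. The algebra induced by $\rho\colon GB\Rightarrow BG$ is the unique $\beta\colon GZ\to Z$ with $\zeta\circ\beta=B\beta\circ\rho_Z\circ G\zeta$. *)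

theory Defs
  imports Main
begin

unbundle cardinal_syntax

section \<open>Categories, functors, natural transformations\<close>

record ('o, 'm) cat =
  Obj :: "'o set"
  Arr :: "'m set"
  Dom :: "'m \<Rightarrow> 'o"
  Cod :: "'m \<Rightarrow> 'o"
  Ide :: "'o \<Rightarrow> 'm"
  Cmp :: "'m \<Rightarrow> 'm \<Rightarrow> 'm"  (infixr "\<cdot>\<index>" 70)

definition Hom :: "('o, 'm) cat \<Rightarrow> 'o \<Rightarrow> 'o \<Rightarrow> 'm set" where
  "Hom C a b = {f \<in> Arr C. Dom C f = a \<and> Cod C f = b}"

locale category =
  fixes C :: "('o, 'm) cat" (structure)
  assumes Dom_Obj: "f \<in> Arr C \<Longrightarrow> Dom C f \<in> Obj C"
    and Cod_Obj: "f \<in> Arr C \<Longrightarrow> Cod C f \<in> Obj C"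
    and Ide_Hom: "a \<in> Obj C \<Longrightarrow> Ide C a \<in> Hom C a a"
    and Cmp_Hom: "f \<in> Hom C a b \<Longrightarrow> g \<in> Hom C b c \<Longrightarrow> g \<cdot> f \<in> Hom C a c"
    and Cmp_Ide_right: "f \<in> Hom C a b \<Longrightarrow> f \<cdot> Ide C a = f"
    and Cmp_Ide_left: "f \<in> Hom C a b \<Longrightarrow> Ide C b \<cdot> f = f"
    and Cmp_assoc: "f \<in> Hom C a b \<Longrightarrow> g \<in> Hom C b c \<Longrightarrow> h \<in> Hom C c d
      \<Longrightarrow> h \<cdot> (g \<cdot> f) = (h \<cdot> g) \<cdot> f"

definition opposite :: "('o, 'm) cat \<Rightarrow> ('o, 'm) cat" where
  "opposite C = \<lparr>Obj = Obj C, Arr = Arr C, Dom = Cod C, Cod = Dom C,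
                 Ide = Ide C, Cmp = (\<lambda>g f. Cmp C f g)\<rparr>"

text \<open>A reflexive and transitive relation as a category; the pair \<open>(i, j)\<close> is the unique arrow
  from \<open>i\<close> to \<open>j\<close>.\<close>

definition order_cat :: "'i rel \<Rightarrow> ('i, 'i \<times> 'i) cat" where
  "order_cat r = \<lparr>Obj = Field r, Arr = r, Dom = fst, Cod = snd,
                  Ide = (\<lambda>i. (i, i)), Cmp = (\<lambda>g f. (fst f, snd g))\<rparr>"

definition is_inverse :: "('o, 'm) cat \<Rightarrow> 'm \<Rightarrow> 'm \<Rightarrow> bool" where
  "is_inverse C f g \<longleftrightarrow> f \<in> Arr C \<and> g \<in> Hom C (Cod C f) (Dom C f)
     \<and> Cmp C g f = Ide C (Dom C f) \<and> Cmp C f g = Ide C (Cod C f)"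

definition is_iso :: "('o, 'm) cat \<Rightarrow> 'm \<Rightarrow> bool" where
  "is_iso C f \<longleftrightarrow> (\<exists>g. is_inverse C f g)"

definition inv_arr :: "('o, 'm) cat \<Rightarrow> 'm \<Rightarrow> 'm" where
  "inv_arr C f = (THE g. is_inverse C f g)"

record ('o, 'm, 'p, 'n) fctr =
  fobj :: "'o \<Rightarrow> 'p"
  farr :: "'m \<Rightarrow> 'n"

definition is_functor :: "('o, 'm) cat \<Rightarrow> ('p, 'n) cat \<Rightarrow> ('o, 'm, 'p, 'n) fctr \<Rightarrow> bool" where
  "is_functor A D F \<longleftrightarrow>
     (\<forall>a \<in> Obj A. fobj F a \<in> Obj D) \<and>
     (\<forall>f \<in> Arr A. farr F f \<in> Hom D (fobj F (Dom A f)) (fobj F (Cod A f))) \<and>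
     (\<forall>a \<in> Obj A. farr F (Ide A a) = Ide D (fobj F a)) \<and>
     (\<forall>f \<in> Arr A. \<forall>g \<in> Arr A. Dom A g = Cod A f \<longrightarrow>
        farr F (Cmp A g f) = Cmp D (farr F g) (farr F f))"

definition id_fctr :: "('o, 'm, 'o, 'm) fctr" where
  "id_fctr = \<lparr>fobj = (\<lambda>a. a), farr = (\<lambda>f. f)\<rparr>"

definition comp_fctr ::
  "('p, 'n, 'q, 'l) fctr \<Rightarrow> ('o, 'm, 'p, 'n) fctr \<Rightarrow> ('o, 'm, 'q, 'l) fctr"  (infixr "\<circ>\<^sub>F" 75) where
  "G \<circ>\<^sub>F F = \<lparr>fobj = (\<lambda>a. fobj G (fobj F a)), farr = (\<lambda>f. farr G (farr F f))\<rparr>"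

definition is_nat ::
  "('o, 'm) cat \<Rightarrow> ('p, 'n) cat \<Rightarrow> ('o, 'm, 'p, 'n) fctr \<Rightarrow> ('o, 'm, 'p, 'n) fctr
    \<Rightarrow> ('o \<Rightarrow> 'n) \<Rightarrow> bool" where
  "is_nat A D F G \<tau> \<longleftrightarrow> is_functor A D F \<and> is_functor A D G \<and>
     (\<forall>a \<in> Obj A. \<tau> a \<in> Hom D (fobj F a) (fobj G a)) \<and>
     (\<forall>f \<in> Arr A. Cmp D (farr G f) (\<tau> (Dom A f)) = Cmp D (\<tau> (Cod A f)) (farr F f))"


section \<open>Limits and completeness\<close>

definition is_terminal :: "('o, 'm) cat \<Rightarrow> 'o \<Rightarrow> bool" where
  "is_terminal C t \<longleftrightarrow> t \<in> Obj C \<and> (\<forall>a \<in> Obj C. \<exists>!f. f \<in> Hom C a t)"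

definition is_cone ::
  "('j, 'k) cat \<Rightarrow> ('o, 'm) cat \<Rightarrow> ('j, 'k, 'o, 'm) fctr \<Rightarrow> 'o \<Rightarrow> ('j \<Rightarrow> 'm) \<Rightarrow> bool" where
  "is_cone J C D c \<pi> \<longleftrightarrow> c \<in> Obj C \<and>
     (\<forall>j \<in> Obj J. \<pi> j \<in> Hom C c (fobj D j)) \<and>
     (\<forall>f \<in> Arr J. Cmp C (farr D f) (\<pi> (Dom J f)) = \<pi> (Cod J f))"

definition is_limit ::
  "('j, 'k) cat \<Rightarrow> ('o, 'm) cat \<Rightarrow> ('j, 'k, 'o, 'm) fctr \<Rightarrow> 'o \<Rightarrow> ('j \<Rightarrow> 'm) \<Rightarrow> bool" where
  "is_limit J C D c \<pi> \<longleftrightarrow> is_cone J C D c \<pi> \<and>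
     (\<forall>x \<xi>. is_cone J C D x \<xi> \<longrightarrow>
        (\<exists>!h. h \<in> Hom C x c \<and> (\<forall>j \<in> Obj J. Cmp C (\<pi> j) h = \<xi> j)))"

definition is_product :: "('o, 'm) cat \<Rightarrow> 'o \<Rightarrow> 'o \<Rightarrow> 'o \<Rightarrow> 'm \<Rightarrow> 'm \<Rightarrow> bool" where
  "is_product C a b c p q \<longleftrightarrow>
     a \<in> Obj C \<and> b \<in> Obj C \<and> c \<in> Obj C \<and> p \<in> Hom C c a \<and> q \<in> Hom C c b \<and>
     (\<forall>x \<in> Obj C. \<forall>f \<in> Hom C x a. \<forall>g \<in> Hom C x b.
        \<exists>!h. h \<in> Hom C x c \<and> Cmp C p h = f \<and> Cmp C q h = g)"

definition pairing :: "('o, 'm) cat \<Rightarrow> 'm \<Rightarrow> 'm \<Rightarrow> 'm \<Rightarrow> 'm \<Rightarrow> 'm" where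
  "pairing C p q f g =
     (THE h. h \<in> Hom C (Dom C f) (Dom C p) \<and> Cmp C p h = f \<and> Cmp C q h = g)"

definition is_product_fctr ::
  "('o, 'm) cat \<Rightarrow> ('o, 'm, 'o, 'm) fctr \<Rightarrow> ('o, 'm, 'o, 'm) fctr \<Rightarrow> ('o, 'm, 'o, 'm) fctr
    \<Rightarrow> ('o \<Rightarrow> 'm) \<Rightarrow> ('o \<Rightarrow> 'm) \<Rightarrow> bool" where
  "is_product_fctr C F G P p q \<longleftrightarrow> is_nat C C P F p \<and> is_nat C C P G q \<and>
     (\<forall>x \<in> Obj C. is_product C (fobj F x) (fobj G x) (fobj P x) (p x) (q x))"

text \<open>
  HOL has no proper classes, so the size of the set-theoretic universe is a parameter: a
  cardinal \<open>\<Omega>\<close>, represented as a well-order of minimal order type.  ``Small'' means of cardinality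
  below \<open>\<Omega>\<close>, and \<open>Ord\<close> is \<open>\<Omega>\<close> itself, viewed as a linearly ordered category: its elements are the
  small ordinals.  The usual universes are the inaccessible \<open>\<Omega>\<close>; only regularity is
  required, since HOL does not prove that uncountable inaccessible cardinals exist.
\<close>

definition universe_size :: "'u rel \<Rightarrow> bool" where
  "universe_size \<Omega> \<longleftrightarrow> Cinfinite \<Omega> \<and> regularCard \<Omega>"

definition small_category :: "'u rel \<Rightarrow> ('j, 'k) cat \<Rightarrow> bool" where
  "small_category \<Omega> J \<longleftrightarrow> category J \<and> |Obj J| <o \<Omega> \<and> |Arr J| <o \<Omega>"

text \<open>Every small category is isomorphic to one whose objects and arrows are elements of \<open>'u\<close>, so
  it suffices to consider diagrams of the latter shape.\<close>

definition complete_category :: "'u rel \<Rightarrow> ('o, 'm) cat \<Rightarrow> bool" where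
  "complete_category \<Omega> C \<longleftrightarrow> category C \<and>
     (\<forall>(J :: ('u, 'u) cat) D. small_category \<Omega> J \<longrightarrow> is_functor J C D \<longrightarrow>
        (\<exists>c \<pi>. is_limit J C D c \<pi>))"


section \<open>The final sequence\<close>

definition ord_zero :: "'u rel \<Rightarrow> 'u \<Rightarrow> bool" where
  "ord_zero \<Omega> i \<longleftrightarrow> i \<in> Field \<Omega> \<and> underS \<Omega> i = {}"

definition ord_suc :: "'u rel \<Rightarrow> 'u \<Rightarrow> 'u" where
  "ord_suc \<Omega> i = wo_rel.suc \<Omega> {i}"

definition ord_limit :: "'u rel \<Rightarrow> 'u \<Rightarrow> bool" where
  "ord_limit \<Omega> j \<longleftrightarrow> j \<in> Field \<Omega> \<and> \<not> ord_zero \<Omega> j \<and> (\<forall>i \<in> Field \<Omega>. j \<noteq> ord_suc \<Omega> i)"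

abbreviation Ord_op :: "'u rel \<Rightarrow> ('u, 'u \<times> 'u) cat" where
  "Ord_op \<Omega> \<equiv> opposite (order_cat \<Omega>)"

text \<open>The connecting map \<open>B\<^bsub>j,i\<^esub>\<close> for \<open>i \<le> j\<close>, of type \<open>B\<^sub>j \<rightarrow> B\<^sub>i\<close>.\<close>

abbreviation conn :: "('u, 'u \<times> 'u, 'o, 'm) fctr \<Rightarrow> 'u \<Rightarrow> 'u \<Rightarrow> 'm" where
  "conn S j i \<equiv> farr S (i, j)"

text \<open>The terminal object and the limits are determined only up to isomorphism; a final sequence
  is the result of any choice of them.  The identity law for the connecting maps is part of
  functoriality.\<close>

definition is_final_sequence ::
  "'u rel \<Rightarrow> ('o, 'm) cat \<Rightarrow> ('o, 'm, 'o, 'm) fctr \<Rightarrow> ('u, 'u \<times> 'u, 'o, 'm) fctr \<Rightarrow> bool" where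
  "is_final_sequence \<Omega> C B S \<longleftrightarrow> is_functor (Ord_op \<Omega>) C S \<and>
     (\<forall>i. ord_zero \<Omega> i \<longrightarrow> is_terminal C (fobj S i)) \<and>
     (\<forall>i \<in> Field \<Omega>. fobj S (ord_suc \<Omega> i) = fobj B (fobj S i)) \<and>
     (\<forall>i j. (i, j) \<in> \<Omega> \<longrightarrow>
        conn S (ord_suc \<Omega> j) (ord_suc \<Omega> i) = farr B (conn S j i)) \<and>
     (\<forall>j. ord_limit \<Omega> j \<longrightarrow>
        is_limit (Ord_op (Restr \<Omega> (underS \<Omega> j))) C S (fobj S j) (\<lambda>i. conn S j i))"


section \<open>Right Kan extensions\<close>

text \<open>\<open>(R, \<epsilon>)\<close> is a right Kan extension of \<open>X : A \<rightarrow> E\<close> along \<open>K : A \<rightarrow> D\<close>.  Transformations are total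
  functions, so uniqueness is understood on the objects of \<open>D\<close>.\<close>

definition is_right_kan_extension ::
  "('a, 'b) cat \<Rightarrow> ('d, 'e) cat \<Rightarrow> ('f, 'g) cat
    \<Rightarrow> ('a, 'b, 'd, 'e) fctr \<Rightarrow> ('a, 'b, 'f, 'g) fctr
    \<Rightarrow> ('d, 'e, 'f, 'g) fctr \<Rightarrow> ('a \<Rightarrow> 'g) \<Rightarrow> bool" where
  "is_right_kan_extension A D E K X R \<epsilon> \<longleftrightarrow>
     is_functor A D K \<and> is_functor A E X \<and> is_functor D E R \<and>
     is_nat A E (R \<circ>\<^sub>F K) X \<epsilon> \<and>
     (\<forall>H \<alpha>. is_functor D E H \<longrightarrow> is_nat A E (H \<circ>\<^sub>F K) X \<alpha> \<longrightarrow>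
        (\<exists>\<tau>. is_nat D E H R \<tau> \<and>
           (\<forall>a \<in> Obj A. \<alpha> a = Cmp E (\<epsilon> a) (\<tau> (fobj K a))) \<and>
           (\<forall>\<sigma>. is_nat D E H R \<sigma> \<and>
              (\<forall>a \<in> Obj A. \<alpha> a = Cmp E (\<epsilon> a) (\<sigma> (fobj K a))) \<longrightarrow>
              (\<forall>d \<in> Obj D. \<sigma> d = \<tau> d))))"

definition is_codensity ::
  "('a, 'b) cat \<Rightarrow> ('o, 'm) cat \<Rightarrow> ('a, 'b, 'o, 'm) fctr
    \<Rightarrow> ('o, 'm, 'o, 'm) fctr \<Rightarrow> ('a \<Rightarrow> 'm) \<Rightarrow> bool" where
  "is_codensity A C K R \<epsilon> \<longleftrightarrow> is_right_kan_extension A C C K K R \<epsilon>"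

definition preserves_codensity ::
  "('a, 'b) cat \<Rightarrow> ('o, 'm) cat \<Rightarrow> ('o, 'm, 'o, 'm) fctr \<Rightarrow> ('a, 'b, 'o, 'm) fctr
    \<Rightarrow> ('o, 'm, 'o, 'm) fctr \<Rightarrow> ('a \<Rightarrow> 'm) \<Rightarrow> bool" where
  "preserves_codensity A C B K R \<epsilon> \<longleftrightarrow>
     is_right_kan_extension A C C K (B \<circ>\<^sub>F K) (B \<circ>\<^sub>F R) (\<lambda>a. farr B (\<epsilon> a))"


section \<open>Coalgebras, monads and free monads\<close>

definition is_coalgebra ::
  "('o, 'm) cat \<Rightarrow> ('o, 'm, 'o, 'm) fctr \<Rightarrow> 'o \<Rightarrow> 'm \<Rightarrow> bool" where
  "is_coalgebra C B x \<xi> \<longleftrightarrow> x \<in> Obj C \<and> \<xi> \<in> Hom C x (fobj B x)"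

definition is_final_coalgebra ::
  "('o, 'm) cat \<Rightarrow> ('o, 'm, 'o, 'm) fctr \<Rightarrow> 'o \<Rightarrow> 'm \<Rightarrow> bool" where
  "is_final_coalgebra C B z \<zeta> \<longleftrightarrow> is_coalgebra C B z \<zeta> \<and>
     (\<forall>x \<xi>. is_coalgebra C B x \<xi> \<longrightarrow>
        (\<exists>!h. h \<in> Hom C x z \<and> Cmp C \<zeta> h = Cmp C (farr B h) \<xi>))"

definition is_algebra ::
  "('o, 'm) cat \<Rightarrow> ('o, 'm, 'o, 'm) fctr \<Rightarrow> 'o \<Rightarrow> 'm \<Rightarrow> bool" where
  "is_algebra C F x \<alpha> \<longleftrightarrow> x \<in> Obj C \<and> \<alpha> \<in> Hom C (fobj F x) x"

definition is_monad ::
  "('o, 'm) cat \<Rightarrow> ('o, 'm, 'o, 'm) fctr \<Rightarrow> ('o \<Rightarrow> 'm) \<Rightarrow> ('o \<Rightarrow> 'm) \<Rightarrow> bool" where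
  "is_monad C T \<eta> \<mu> \<longleftrightarrow> is_nat C C id_fctr T \<eta> \<and> is_nat C C (T \<circ>\<^sub>F T) T \<mu> \<and>
     (\<forall>x \<in> Obj C.
        Cmp C (\<mu> x) (\<eta> (fobj T x)) = Ide C (fobj T x) \<and>
        Cmp C (\<mu> x) (farr T (\<eta> x)) = Ide C (fobj T x) \<and>
        Cmp C (\<mu> x) (\<mu> (fobj T x)) = Cmp C (\<mu> x) (farr T (\<mu> x)))"

definition is_EM_algebra ::
  "('o, 'm) cat \<Rightarrow> ('o, 'm, 'o, 'm) fctr \<Rightarrow> ('o \<Rightarrow> 'm) \<Rightarrow> ('o \<Rightarrow> 'm) \<Rightarrow> 'o \<Rightarrow> 'm \<Rightarrow> bool" where
  "is_EM_algebra C T \<eta> \<mu> x a \<longleftrightarrow> is_algebra C T x a \<and>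
     Cmp C a (\<eta> x) = Ide C x \<and> Cmp C a (\<mu> x) = Cmp C a (farr T a)"

text \<open>The free monad \<open>(T, \<eta>, \<mu>)\<close> on \<open>F\<close>, with inclusion \<open>\<iota> : F \<Rightarrow> T\<close>, is the monad of the
  adjunction between \<open>C\<close> and the \<open>F\<close>-algebras: \<open>T x\<close> carries the free \<open>F\<close>-algebra on \<open>x\<close>, with
  structure map \<open>\<mu>\<^sub>x \<circ> \<iota>\<^bsub>T x\<^esub>\<close> and unit \<open>\<eta>\<^sub>x\<close>.\<close>

definition is_free_monad ::
  "('o, 'm) cat \<Rightarrow> ('o, 'm, 'o, 'm) fctr \<Rightarrow> ('o, 'm, 'o, 'm) fctr
    \<Rightarrow> ('o \<Rightarrow> 'm) \<Rightarrow> ('o \<Rightarrow> 'm) \<Rightarrow> ('o \<Rightarrow> 'm) \<Rightarrow> bool" where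
  "is_free_monad C F T \<eta> \<mu> \<iota> \<longleftrightarrow> is_monad C T \<eta> \<mu> \<and> is_nat C C F T \<iota> \<and>
     (\<forall>x \<in> Obj C. \<forall>y a. \<forall>f \<in> Hom C x y. is_algebra C F y a \<longrightarrow>
        (\<exists>!h. h \<in> Hom C (fobj T x) y \<and> Cmp C h (\<eta> x) = f \<and>
           Cmp C h (Cmp C (\<mu> x) (\<iota> (fobj T x))) = Cmp C a (farr F h)))"

definition EM_ext ::
  "('o, 'm) cat \<Rightarrow> ('o, 'm, 'o, 'm) fctr \<Rightarrow> ('o \<Rightarrow> 'm) \<Rightarrow> ('o \<Rightarrow> 'm) \<Rightarrow> ('o \<Rightarrow> 'm)
    \<Rightarrow> 'o \<Rightarrow> 'm \<Rightarrow> 'm" where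
  "EM_ext C T \<eta> \<mu> \<iota> x \<alpha> = (THE a. is_EM_algebra C T \<eta> \<mu> x a \<and> Cmp C a (\<iota> x) = \<alpha>)"


section \<open>Induced algebras\<close>

text \<open>\<open>P\<close> with projections \<open>p\<close>, \<open>q\<close> is the functor \<open>B \<times> Id\<close>.\<close>

definition gsos_equation where
  "gsos_equation C B F T \<eta> \<mu> \<iota> p q l z \<zeta> \<alpha> \<longleftrightarrow>
     Cmp C \<zeta> \<alpha> =
       Cmp C (farr B (EM_ext C T \<eta> \<mu> \<iota> z \<alpha>))
         (Cmp C (l z) (farr F (pairing C (p z) (q z) \<zeta> (Ide C z))))"

definition gsos_induced ::
  "('o, 'm) cat \<Rightarrow> ('o, 'm, 'o, 'm) fctr \<Rightarrow> ('o, 'm, 'o, 'm) fctr \<Rightarrow> ('o, 'm, 'o, 'm) fctr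
    \<Rightarrow> ('o \<Rightarrow> 'm) \<Rightarrow> ('o \<Rightarrow> 'm) \<Rightarrow> ('o \<Rightarrow> 'm) \<Rightarrow> ('o \<Rightarrow> 'm) \<Rightarrow> ('o \<Rightarrow> 'm)
    \<Rightarrow> ('o \<Rightarrow> 'm) \<Rightarrow> 'o \<Rightarrow> 'm \<Rightarrow> 'm \<Rightarrow> bool" where
  "gsos_induced C B F T \<eta> \<mu> \<iota> p q l z \<zeta> \<alpha> \<longleftrightarrow>
     is_algebra C F z \<alpha> \<and> gsos_equation C B F T \<eta> \<mu> \<iota> p q l z \<zeta> \<alpha> \<and>
     (\<forall>\<alpha>'. is_algebra C F z \<alpha>' \<and> gsos_equation C B F T \<eta> \<mu> \<iota> p q l z \<zeta> \<alpha>' \<longrightarrow> \<alpha>' = \<alpha>)"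

definition dlaw_equation where
  "dlaw_equation C B G \<rho> z \<zeta> \<beta> \<longleftrightarrow>
     Cmp C \<zeta> \<beta> = Cmp C (farr B \<beta>) (Cmp C (\<rho> z) (farr G \<zeta>))"

definition dlaw_induced ::
  "('o, 'm) cat \<Rightarrow> ('o, 'm, 'o, 'm) fctr \<Rightarrow> ('o, 'm, 'o, 'm) fctr \<Rightarrow> ('o \<Rightarrow> 'm)
    \<Rightarrow> 'o \<Rightarrow> 'm \<Rightarrow> 'm \<Rightarrow> bool" where
  "dlaw_induced C B G \<rho> z \<zeta> \<beta> \<longleftrightarrow>
     is_algebra C G z \<beta> \<and> dlaw_equation C B G \<rho> z \<zeta> \<beta> \<and>
     (\<forall>\<beta>'. is_algebra C G z \<beta>' \<and> dlaw_equation C B G \<rho> z \<zeta> \<beta>' \<longrightarrow> \<beta>' = \<beta>)"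

definition definable_by_dlaw ::
  "('o, 'm) cat \<Rightarrow> ('o, 'm, 'o, 'm) fctr \<Rightarrow> ('o, 'm, 'o, 'm) fctr \<Rightarrow> 'o \<Rightarrow> 'm \<Rightarrow> 'm \<Rightarrow> bool" where
  "definable_by_dlaw C B F z \<zeta> \<alpha> \<longleftrightarrow>
     (\<exists>G \<rho> \<beta> \<kappa>. is_functor C C G \<and> is_nat C C (G \<circ>\<^sub>F B) (B \<circ>\<^sub>F G) \<rho> \<and>
        dlaw_induced C B G \<rho> z \<zeta> \<beta> \<and> is_nat C C F G \<kappa> \<and> \<alpha> = Cmp C \<beta> (\<kappa> z))"

end

theory Submission
  imports Defs
begin

text \<open>
  Every stage of the final sequence, be it at zero, at a successor or at a limit, is the limit
  \<open>B\<^sub>j = lim\<^bsub>i<j\<^esub> B B\<^sub>i\<close>.  Hence an operation that extends maps \<open>H\<^sub>i \<rightarrow> B\<^sub>i\<close> to maps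
  \<open>H\<^bsub>i+1\<^esub> \<rightarrow> B\<^bsub>i+1\<^esub>\<close>, compatibly with the connecting maps, can be iterated to a natural family
  \<open>H\<^sub>i \<rightarrow> B\<^sub>i\<close> without distinguishing cases.  For a coalgebra \<open>\<xi> : x \<rightarrow> B x\<close>, iterating
  \<open>f \<mapsto> B f \<circ> \<xi>\<close> yields a homomorphism to \<open>B\<^sub>k\<close>; it is unique because its projections to all
  \<open>B\<^bsub>i+1\<^esub>\<close> below are determined inductively.

  A GSOS specification \<open>\<lambda>\<close> defines algebras on the whole final sequence in this way, namely
  \<open>\<alpha>\<^bsub>i+1\<^esub> = B \<alpha>\<^sub>i\<^sup>* \<circ> \<lambda> \<circ> F \<langle>id, B\<^bsub>i+1,i\<^esub>\<rangle>\<close>.  At \<open>k\<close> this recursion becomes the GSOS equation, so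
  \<open>\<alpha>\<^sub>k\<close> is the algebra induced by \<open>\<lambda>\<close>.

  The functor \<open>G\<close> is the codensity monad \<open>R\<close> itself.  Since \<open>B\<close> preserves it, the family
  \<open>\<epsilon>\<^bsub>i+1\<^esub> : R B B\<^sub>i \<rightarrow> B B\<^sub>i\<close> factors through \<open>B \<epsilon>\<close> and yields \<open>\<rho> : R B \<Rightarrow> B R\<close> with
  \<open>B \<epsilon>\<^sub>i \<circ> \<rho> = \<epsilon>\<^bsub>i+1\<^esub>\<close>; naturality of \<open>\<epsilon>\<close> at \<open>B\<^bsub>k+1,k\<^esub>\<close> shows that \<open>\<epsilon>\<^sub>k\<close> is the algebra induced
  by \<open>\<rho>\<close>.  The family \<open>\<alpha>\<close> corresponds to some \<open>\<kappa> : F \<Rightarrow> R\<close> with \<open>\<alpha>\<^sub>i = \<epsilon>\<^sub>i \<circ> \<kappa>\<close>.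
\<close>

section \<open>Arrows, functors and natural transformations\<close>

declare Hom_def [simp]

context category
begin

abbreviation in_hom :: "'m \<Rightarrow> 'o \<Rightarrow> 'o \<Rightarrow> bool"  ("\<guillemotleft>_ : _ \<rightarrow> _\<guillemotright>") where
  "\<guillemotleft>f : a \<rightarrow> b\<guillemotright> \<equiv> f \<in> Hom C a b"

declare Dom_Obj [simp] Cod_Obj [simp]

lemma in_hom_Obj:
  assumes "\<guillemotleft>f : a \<rightarrow> b\<guillemotright>"
  shows "a \<in> Obj C" "b \<in> Obj C"
  using assms Dom_Obj[of f] Cod_Obj[of f] by auto

lemma Ide_simps [simp]:
  assumes "a \<in> Obj C"
  shows "Ide C a \<in> Arr C" "Dom C (Ide C a) = a" "Cod C (Ide C a) = a"
  using Ide_Hom[OF assms] by simp_all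

lemma Cmp_simps [simp]:
  assumes "f \<in> Arr C" "g \<in> Arr C" "Dom C g = Cod C f"
  shows "g \<cdot> f \<in> Arr C" "Dom C (g \<cdot> f) = Dom C f" "Cod C (g \<cdot> f) = Cod C g"
  using Cmp_Hom[of f "Dom C f" "Cod C f" g "Cod C g"] assms by simp_all

lemma Cmp_assoc_right [simp]:
  assumes "f \<in> Arr C" "g \<in> Arr C" "h \<in> Arr C" "Dom C g = Cod C f" "Dom C h = Cod C g"
  shows "(h \<cdot> g) \<cdot> f = h \<cdot> (g \<cdot> f)"
  using Cmp_assoc[of f "Dom C f" "Cod C f" g "Cod C g" h "Cod C h"] assms by simp

lemma Cmp_Ide [simp]:
  assumes "f \<in> Arr C"
  shows "Dom C f = a \<Longrightarrow> f \<cdot> Ide C a = f" "Cod C f = a \<Longrightarrow> Ide C a \<cdot> f = f"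
  using Cmp_Ide_right[of f "Dom C f" "Cod C f"] Cmp_Ide_left[of f "Dom C f" "Cod C f"] assms
  by auto

lemma Cmp_eq_extend:
  assumes "g \<cdot> f = h" "f \<in> Arr C" "g \<in> Arr C" "Dom C g = Cod C f" "x \<in> Arr C" "Cod C x = Dom C f"
  shows "g \<cdot> (f \<cdot> x) = h \<cdot> x"
  using Cmp_assoc_right[of x f g] assms by simp

lemma inverse_unique:
  assumes "is_inverse C f g" "is_inverse C f h"
  shows "g = h"
proof -
  have "g = g \<cdot> (f \<cdot> h)" using assms by (simp add: is_inverse_def)
  also have "\<dots> = (g \<cdot> f) \<cdot> h" using assms Cmp_assoc_right[of h f g] by (simp add: is_inverse_def)
  also have "\<dots> = h" using assms by (simp add: is_inverse_def)
  finally show ?thesis .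
qed

lemma inverse_inv_arr:
  assumes "is_iso C f"
  shows "is_inverse C f (inv_arr C f)"
  unfolding inv_arr_def using assms inverse_unique by (metis is_iso_def theI')

end

lemma functor_simps:
  assumes "is_functor A D F"
  shows "a \<in> Obj A \<Longrightarrow> fobj F a \<in> Obj D"
    and "f \<in> Arr A \<Longrightarrow> farr F f \<in> Arr D"
    and "f \<in> Arr A \<Longrightarrow> Dom D (farr F f) = fobj F (Dom A f)"
    and "f \<in> Arr A \<Longrightarrow> Cod D (farr F f) = fobj F (Cod A f)"
    and "a \<in> Obj A \<Longrightarrow> farr F (Ide A a) = Ide D (fobj F a)"
    and "f \<in> Arr A \<Longrightarrow> g \<in> Arr A \<Longrightarrow> Dom A g = Cod A f
      \<Longrightarrow> farr F (Cmp A g f) = Cmp D (farr F g) (farr F f)"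
  using assms by (auto simp: is_functor_def)

lemma comp_fctr_simps [simp]:
  "fobj (G \<circ>\<^sub>F F) a = fobj G (fobj F a)" "farr (G \<circ>\<^sub>F F) f = farr G (farr F f)"
  by (simp_all add: comp_fctr_def)

lemma id_fctr_simps [simp]: "fobj id_fctr a = a" "farr id_fctr f = f"
  by (simp_all add: id_fctr_def)

lemma is_functor_comp:
  assumes "is_functor A D F" "is_functor D E G"
  shows "is_functor A E (G \<circ>\<^sub>F F)"
  using assms by (auto simp: is_functor_def)

lemma is_nat_functors:
  assumes "is_nat A D F G \<tau>"
  shows "is_functor A D F" "is_functor A D G"
  using assms by (simp_all add: is_nat_def)

lemma nat_simps:
  assumes "is_nat A D F G \<tau>" "a \<in> Obj A"
  shows "\<tau> a \<in> Arr D" "Dom D (\<tau> a) = fobj F a" "Cod D (\<tau> a) = fobj G a"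
  using assms by (auto simp: is_nat_def)

lemma naturality:
  assumes "is_nat A D F G \<tau>" "f \<in> Arr A" "Dom A f = a"
  shows "Cmp D (farr G f) (\<tau> a) = Cmp D (\<tau> (Cod A f)) (farr F f)"
  using assms by (auto simp: is_nat_def)

context category
begin

lemmas endofunctor_simps [simp] = functor_simps[of C C]

lemma naturality_extend:
  assumes nat: "is_nat A C F G \<tau>" and "f \<in> Arr A" "Dom A f = a" "a \<in> Obj A" "Cod A f \<in> Obj A"
    and "x \<in> Arr C" "Cod C x = fobj F a"
  shows "farr G f \<cdot> (\<tau> a \<cdot> x) = \<tau> (Cod A f) \<cdot> (farr F f \<cdot> x)"
proof -
  note [simp] = nat_simps[OF nat] functor_simps[OF is_nat_functors(1)[OF nat]]
    functor_simps[OF is_nat_functors(2)[OF nat]]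
  show ?thesis
    using Cmp_eq_extend[OF naturality[OF nat]] assms by simp
qed

end

section \<open>Free algebras and Eilenberg--Moore extensions\<close>

definition is_algebra_hom ::
  "('o, 'm) cat \<Rightarrow> ('o, 'm, 'o, 'm) fctr \<Rightarrow> 'o \<Rightarrow> 'm \<Rightarrow> 'o \<Rightarrow> 'm \<Rightarrow> 'm \<Rightarrow> bool" where
  "is_algebra_hom C F x a y b h \<longleftrightarrow> is_algebra C F x a \<and> is_algebra C F y b \<and>
     h \<in> Hom C x y \<and> Cmp C h a = Cmp C b (farr F h)"

lemma (in category) algebra_hom_Cmp:
  assumes endofunctor: "is_functor C C F"
    and hom_f: "is_algebra_hom C F x a y b f" and hom_g: "is_algebra_hom C F y b z c g"
  shows "is_algebra_hom C F x a z c (g \<cdot> f)"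
proof -
  note [simp] = endofunctor is_algebra_hom_def is_algebra_def
  have "(g \<cdot> f) \<cdot> a = g \<cdot> (b \<cdot> farr F f)"
    using hom_f hom_g by simp
  also have "\<dots> = c \<cdot> farr F (g \<cdot> f)"
    using hom_f hom_g Cmp_eq_extend[of g b "c \<cdot> farr F g" "farr F f"] by simp
  finally show ?thesis
    using hom_f hom_g by simp
qed

locale free_monad = category C for C :: "('o, 'm) cat" (structure) +
  fixes F T :: "('o, 'm, 'o, 'm) fctr" and \<eta> \<mu> \<iota> :: "'o \<Rightarrow> 'm"
  assumes F_functor [simp]: "is_functor C C F" and free: "is_free_monad C F T \<eta> \<mu> \<iota>"
begin

lemma eta_natural: "is_nat C C id_fctr T \<eta>" and mu_natural: "is_nat C C (T \<circ>\<^sub>F T) T \<mu>"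
  and iota_natural: "is_nat C C F T \<iota>" and T_functor [simp]: "is_functor C C T"
  using free by (auto simp: is_free_monad_def is_monad_def is_nat_def)

lemma monad_laws [simp]:
  assumes "x \<in> Obj C"
  shows "\<mu> x \<cdot> \<eta> (fobj T x) = Ide C (fobj T x)" "\<mu> x \<cdot> farr T (\<eta> x) = Ide C (fobj T x)"
    "\<mu> x \<cdot> farr T (\<mu> x) = \<mu> x \<cdot> \<mu> (fobj T x)"
  using free assms by (auto simp: is_free_monad_def is_monad_def)

lemmas monad_simps [simp] = nat_simps[OF eta_natural, simplified]
  nat_simps[OF mu_natural, simplified] nat_simps[OF iota_natural]

lemmas monad_naturality =
  naturality[OF eta_natural, simplified] naturality_extend[OF eta_natural, simplified]
  naturality[OF mu_natural, simplified] naturality_extend[OF mu_natural, simplified]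
  naturality[OF iota_natural] naturality_extend[OF iota_natural]

definition free_algebra :: "'o \<Rightarrow> 'm" where
  "free_algebra x = \<mu> x \<cdot> \<iota> (fobj T x)"

abbreviation is_free_algebra_hom :: "'o \<Rightarrow> 'o \<Rightarrow> 'm \<Rightarrow> 'm \<Rightarrow> bool" where
  "is_free_algebra_hom x \<equiv> is_algebra_hom C F (fobj T x) (free_algebra x)"

lemma free_algebra_is_algebra: "x \<in> Obj C \<Longrightarrow> is_algebra C F (fobj T x) (free_algebra x)"
  by (simp add: is_algebra_def free_algebra_def)

lemma free_algebra_universal:
  assumes algebra: "is_algebra C F y a" and hom: "\<guillemotleft>f : x \<rightarrow> y\<guillemotright>"
  shows "\<exists>!h. is_free_algebra_hom x y a h \<and> h \<cdot> \<eta> x = f"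
proof -
  have x_Obj: "x \<in> Obj C" by (rule in_hom_Obj[OF hom])
  then have "\<exists>!h. \<guillemotleft>h : fobj T x \<rightarrow> y\<guillemotright> \<and> h \<cdot> \<eta> x = f \<and> h \<cdot> free_algebra x = a \<cdot> farr F h"
    using free algebra hom unfolding is_free_monad_def free_algebra_def by blast
  then show ?thesis
    using algebra free_algebra_is_algebra[OF x_Obj] unfolding is_algebra_hom_def by metis
qed

lemma free_algebra_hom_eqI:
  assumes hom: "is_free_algebra_hom x y a h"
    and hom': "is_free_algebra_hom x y a h'"
    and x_Obj: "x \<in> Obj C" and unit_eq: "h \<cdot> \<eta> x = h' \<cdot> \<eta> x"
  shows "h = h'"
proof -
  have "is_algebra C F y a" "\<guillemotleft>h \<cdot> \<eta> x : x \<rightarrow> y\<guillemotright>"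
    using hom x_Obj by (simp_all add: is_algebra_hom_def)
  from free_algebra_universal[OF this] show ?thesis
    using hom hom' unit_eq by metis
qed

lemma mu_algebra_hom:
  assumes "x \<in> Obj C"
  shows "is_free_algebra_hom (fobj T x) (fobj T x) (free_algebra x) (\<mu> x)"
proof -
  have "\<mu> x \<cdot> free_algebra (fobj T x) = \<mu> x \<cdot> (farr T (\<mu> x) \<cdot> \<iota> (fobj T (fobj T x)))"
    using assms Cmp_eq_extend[OF monad_laws(3)[OF assms], of "\<iota> (fobj T (fobj T x))"]
    by (simp add: free_algebra_def)
  also have "\<dots> = free_algebra x \<cdot> farr F (\<mu> x)"
    using assms by (simp add: free_algebra_def monad_naturality)
  finally show ?thesis
    using assms by (simp add: is_algebra_hom_def free_algebra_is_algebra)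
qed

lemma map_algebra_hom:
  assumes "\<guillemotleft>f : x \<rightarrow> y\<guillemotright>"
  shows "is_free_algebra_hom x (fobj T y) (free_algebra y) (farr T f)"
proof -
  have "farr T f \<cdot> free_algebra x = free_algebra y \<cdot> farr F (farr T f)"
    using assms in_hom_Obj[OF assms] by (simp add: free_algebra_def monad_naturality)
  then show ?thesis
    using assms in_hom_Obj[OF assms] by (simp add: is_algebra_hom_def free_algebra_is_algebra)
qed

lemma EM_algebra_is_algebra_hom:
  assumes EM: "is_EM_algebra C T \<eta> \<mu> x h"
  shows "is_free_algebra_hom x x (h \<cdot> \<iota> x) h"
proof -
  note [simp] = is_EM_algebra_def is_algebra_def
  have x_Obj: "x \<in> Obj C" using EM by simp
  have "h \<cdot> free_algebra x = h \<cdot> (farr T h \<cdot> \<iota> (fobj T x))"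
    using EM Cmp_eq_extend[of h "\<mu> x" _ "\<iota> (fobj T x)"] by (simp add: free_algebra_def)
  also have "\<dots> = (h \<cdot> \<iota> x) \<cdot> farr F h"
    using EM by (simp add: monad_naturality)
  finally show ?thesis
    using EM free_algebra_is_algebra[OF x_Obj] by (simp add: is_algebra_hom_def)
qed

lemma retraction_is_EM_algebra:
  assumes x_Obj: "x \<in> Obj C" and free_hom: "is_free_algebra_hom x x a h"
    and unit: "h \<cdot> \<eta> x = Ide C x"
  shows "is_EM_algebra C T \<eta> \<mu> x h" "h \<cdot> \<iota> x = a"
proof -
  have typing: "\<guillemotleft>h : fobj T x \<rightarrow> x\<guillemotright>" "\<guillemotleft>a : fobj F x \<rightarrow> x\<guillemotright>"
    and h_free: "h \<cdot> (\<mu> x \<cdot> \<iota> (fobj T x)) = a \<cdot> farr F h"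
    using free_hom by (simp_all add: is_algebra_hom_def is_algebra_def free_algebra_def)
  have "h \<cdot> \<mu> x = h \<cdot> farr T h"
  proof (rule free_algebra_hom_eqI)
    show "is_free_algebra_hom (fobj T x) x a (h \<cdot> \<mu> x)"
      "is_free_algebra_hom (fobj T x) x a (h \<cdot> farr T h)"
      using algebra_hom_Cmp[OF F_functor _ free_hom] mu_algebra_hom[OF x_Obj]
        map_algebra_hom[OF typing(1)] by blast+
    have "(h \<cdot> farr T h) \<cdot> \<eta> (fobj T x) = h \<cdot> (\<eta> x \<cdot> h)"
      using typing x_Obj by (simp add: monad_naturality)
    then show "(h \<cdot> \<mu> x) \<cdot> \<eta> (fobj T x) = (h \<cdot> farr T h) \<cdot> \<eta> (fobj T x)"
      using typing x_Obj Cmp_eq_extend[OF unit, of h] by simp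
  qed (use x_Obj in simp)
  then show "is_EM_algebra C T \<eta> \<mu> x h"
    using x_Obj typing unit by (simp add: is_EM_algebra_def is_algebra_def)
  have "h \<cdot> \<iota> x = h \<cdot> (\<mu> x \<cdot> (farr T (\<eta> x) \<cdot> \<iota> x))"
    using typing x_Obj Cmp_eq_extend[OF monad_laws(2)[OF x_Obj], of "\<iota> x"] by simp
  also have "\<dots> = (h \<cdot> (\<mu> x \<cdot> \<iota> (fobj T x))) \<cdot> farr F (\<eta> x)"
    using typing x_Obj by (simp add: monad_naturality)
  also have "\<dots> = a \<cdot> farr F (h \<cdot> \<eta> x)"
    unfolding h_free using typing x_Obj by simp
  finally show "h \<cdot> \<iota> x = a"
    using typing x_Obj by (simp add: unit)
qed

lemma EM_algebra_extension_ex1: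
  assumes algebra: "is_algebra C F x a"
  shows "\<exists>!h. is_EM_algebra C T \<eta> \<mu> x h \<and> h \<cdot> \<iota> x = a"
proof -
  have x_Obj: "x \<in> Obj C" using algebra by (simp add: is_algebra_def)
  have "is_EM_algebra C T \<eta> \<mu> x h \<and> h \<cdot> \<iota> x = a \<longleftrightarrow>
      is_free_algebra_hom x x a h \<and> h \<cdot> \<eta> x = Ide C x" for h
    using EM_algebra_is_algebra_hom[of x h] retraction_is_EM_algebra[OF x_Obj, of a h]
    by (auto simp: is_EM_algebra_def)
  then show ?thesis
    using free_algebra_universal[OF algebra Ide_Hom[OF x_Obj]] by simp
qed

abbreviation ext :: "'o \<Rightarrow> 'm \<Rightarrow> 'm" where
  "ext x a \<equiv> EM_ext C T \<eta> \<mu> \<iota> x a"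

lemma ext_algebra_hom:
  assumes "is_algebra C F x a"
  shows "is_free_algebra_hom x x a (ext x a)"
    and "ext x a \<cdot> \<eta> x = Ide C x"
proof -
  have "is_EM_algebra C T \<eta> \<mu> x (ext x a) \<and> ext x a \<cdot> \<iota> x = a"
    unfolding EM_ext_def by (rule theI'[OF EM_algebra_extension_ex1[OF assms]])
  then show "is_free_algebra_hom x x a (ext x a)"
    and "ext x a \<cdot> \<eta> x = Ide C x"
    using EM_algebra_is_algebra_hom[of x "ext x a"] by (auto simp: is_EM_algebra_def)
qed

lemma ext_in_hom:
  assumes "\<guillemotleft>a : fobj F x \<rightarrow> x\<guillemotright>"
  shows "\<guillemotleft>ext x a : fobj T x \<rightarrow> x\<guillemotright>"
  using ext_algebra_hom(1)[of x a] assms in_hom_Obj[OF assms]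
  by (simp add: is_algebra_hom_def is_algebra_def)

lemma ext_natural:
  assumes alg_hom: "is_algebra_hom C F x a y b f"
  shows "f \<cdot> ext x a = ext y b \<cdot> farr T f"
proof (rule free_algebra_hom_eqI)
  have domain: "is_algebra C F x a" and codomain: "is_algebra C F y b" and hom: "\<guillemotleft>f : x \<rightarrow> y\<guillemotright>"
    using alg_hom by (auto simp: is_algebra_hom_def)
  show x_Obj: "x \<in> Obj C" using domain by (simp add: is_algebra_def)
  show "is_free_algebra_hom x y b (f \<cdot> ext x a)"
    "is_free_algebra_hom x y b (ext y b \<cdot> farr T f)"
    using algebra_hom_Cmp[OF F_functor] ext_algebra_hom(1)[OF domain]
      ext_algebra_hom(1)[OF codomain] map_algebra_hom[OF hom] alg_hom by blast+
  have ext_typing: "\<guillemotleft>ext x a : fobj T x \<rightarrow> x\<guillemotright>" "\<guillemotleft>ext y b : fobj T y \<rightarrow> y\<guillemotright>"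
    using domain codomain by (simp_all only: is_algebra_def ext_in_hom)
  have "(ext y b \<cdot> farr T f) \<cdot> \<eta> x = ext y b \<cdot> (\<eta> y \<cdot> f)"
    using hom x_Obj ext_typing by (simp add: monad_naturality)
  also have "\<dots> = f"
    using hom in_hom_Obj[OF hom] ext_typing
      Cmp_eq_extend[OF ext_algebra_hom(2)[OF codomain], of f] by simp
  finally show "(f \<cdot> ext x a) \<cdot> \<eta> x = (ext y b \<cdot> farr T f) \<cdot> \<eta> x"
    using hom x_Obj ext_typing ext_algebra_hom(2)[OF domain] by simp
qed

end

section \<open>Well-orders without a greatest element\<close>

locale unbounded_wo_rel = wo_rel \<Omega> for \<Omega> :: "'u rel" +
  assumes unbounded: "i \<in> Field \<Omega> \<Longrightarrow> \<exists>j \<in> Field \<Omega>. i \<noteq> j \<and> (i, j) \<in> \<Omega>"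
begin

abbreviation le :: "'u \<Rightarrow> 'u \<Rightarrow> bool"  (infix "\<preceq>" 50) where
  "i \<preceq> j \<equiv> (i, j) \<in> \<Omega>"

abbreviation less :: "'u \<Rightarrow> 'u \<Rightarrow> bool"  (infix "\<prec>" 50) where
  "i \<prec> j \<equiv> i \<in> underS j"

abbreviation succ :: "'u \<Rightarrow> 'u" where
  "succ i \<equiv> ord_suc \<Omega> i"

lemma le_Field:
  assumes "i \<preceq> j"
  shows "i \<in> Field \<Omega>" "j \<in> Field \<Omega>"
  using assms by (auto simp: Field_def)

lemma le_refl: "i \<in> Field \<Omega> \<Longrightarrow> i \<preceq> i"
  using REFL by (auto simp: refl_on_def)

lemma le_trans: "i \<preceq> j \<Longrightarrow> j \<preceq> l \<Longrightarrow> i \<preceq> l"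
  using TRANS by (auto simp: trans_def)

lemma le_antisym: "i \<preceq> j \<Longrightarrow> j \<preceq> i \<Longrightarrow> i = j"
  using ANTISYM by (auto simp: antisym_def)

lemma less_imp_le: "i \<prec> j \<Longrightarrow> i \<preceq> j"
  by (simp add: underS_def)

lemma le_less_trans: "i \<preceq> j \<Longrightarrow> j \<prec> l \<Longrightarrow> i \<prec> l"
  using le_trans le_antisym by (auto simp: underS_def)

lemma less_le_trans: "i \<prec> j \<Longrightarrow> j \<preceq> l \<Longrightarrow> i \<prec> l"
  using le_trans le_antisym by (auto simp: underS_def)

lemma less_succ:
  assumes "i \<in> Field \<Omega>"
  shows "i \<prec> succ i"
proof -
  have "AboveS {i} \<noteq> {}"
    using unbounded[OF assms] by (auto simp: AboveS_def)
  then show ?thesis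
    using suc_greater[of "{i}" i] assms by (auto simp: ord_suc_def underS_def)
qed

lemma succ_Field: "i \<in> Field \<Omega> \<Longrightarrow> succ i \<in> Field \<Omega>"
  using less_succ less_imp_le le_Field(2) by blast

lemma le_succ: "i \<in> Field \<Omega> \<Longrightarrow> i \<preceq> succ i"
  using less_succ less_imp_le by blast

lemma succ_le: "i \<prec> j \<Longrightarrow> succ i \<preceq> j"
  unfolding ord_suc_def by (rule suc_least_AboveS) (auto simp: AboveS_def underS_def Field_def)

lemma less_succ_iff:
  assumes "j \<in> Field \<Omega>"
  shows "i \<prec> succ j \<longleftrightarrow> i \<preceq> j"
proof
  assume less: "i \<prec> succ j"
  have "\<not> j \<prec> i"
    using less_le_trans[OF less succ_le, of i] by (auto simp: underS_def)
  moreover have "i \<in> Field \<Omega>"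
    using less by (rule underS_Field)
  ultimately show "i \<preceq> j"
    using TOTALS le_refl assms by (auto simp: underS_def)
qed (use less_succ[OF assms] le_less_trans in blast)

lemma succ_mono: "i \<preceq> j \<Longrightarrow> succ i \<preceq> succ j"
  using less_succ le_less_trans succ_le le_Field(2) by blast

lemma ord_cases:
  assumes "j \<in> Field \<Omega>"
  obtains (zero) "ord_zero \<Omega> j"
    | (succ) i where "i \<in> Field \<Omega>" "j = succ i"
    | (limit) "ord_limit \<Omega> j"
  using assms by (auto simp: ord_limit_def)

lemma succ_less_limit:
  assumes "ord_limit \<Omega> j" "i \<prec> j"
  shows "succ i \<prec> j"
  using assms succ_le[of i j] underS_Field[of i \<Omega> j] by (auto simp: ord_limit_def underS_def)

end

lemma unbounded_wo_rel_universe: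
  assumes "universe_size \<Omega>"
  shows "unbounded_wo_rel \<Omega>"
proof
  show "Well_order \<Omega>"
    using assms by (simp add: universe_size_def card_order_on_def)
  show "\<exists>j \<in> Field \<Omega>. i \<noteq> j \<and> (i, j) \<in> \<Omega>" if "i \<in> Field \<Omega>" for i
    using assms that infinite_Card_order_limit[of \<Omega> i]
    by (simp add: universe_size_def cinfinite_def)
qed

section \<open>The stages of the final sequence as limits\<close>

lemma Ord_op_simps [simp]:
  "Obj (Ord_op r) = Field r" "Arr (Ord_op r) = r" "Dom (Ord_op r) = snd" "Cod (Ord_op r) = fst"
  "Ide (Ord_op r) i = (i, i)" "Cmp (Ord_op r) g f = (fst g, snd f)"
  by (simp_all add: opposite_def order_cat_def)

locale category_with_order = category C + unbounded_wo_rel \<Omega>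
  for C :: "('o, 'm) cat" (structure) and \<Omega> :: "'u rel"
begin

abbreviation Below_op :: "'u \<Rightarrow> ('u, 'u \<times> 'u) cat" where
  "Below_op j \<equiv> Ord_op (Restr \<Omega> (underS j))"

lemma Field_Restr_underS [simp]: "Field (Restr \<Omega> (underS j)) = underS j"
  using Refl_Field_Restr2[OF REFL] by (auto dest: underS_Field)

lemma sequence_simps [simp]:
  assumes "is_functor (Ord_op \<Omega>) C H"
  shows "i \<in> Field \<Omega> \<Longrightarrow> fobj H i \<in> Obj C"
    and "i \<in> Field \<Omega> \<Longrightarrow> conn H i i = Ide C (fobj H i)"
    and "i \<preceq> j \<Longrightarrow> conn H j i \<in> Arr C"
    and "i \<preceq> j \<Longrightarrow> Dom C (conn H j i) = fobj H j"
    and "i \<preceq> j \<Longrightarrow> Cod C (conn H j i) = fobj H i"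
  using functor_simps(1,5)[OF assms, of i] functor_simps(2-4)[OF assms, of "(i, j)"] by simp_all

lemma conn_Cmp:
  assumes "is_functor (Ord_op \<Omega>) C H" "i \<preceq> j" "j \<preceq> l"
  shows "conn H j i \<cdot> conn H l j = conn H l i"
  using functor_simps(6)[OF assms(1), of "(j, l)" "(i, j)"] assms(2,3) by simp

lemma conn_Cmp_extend:
  assumes sequence: "is_functor (Ord_op \<Omega>) C H" and order: "i \<preceq> j" "j \<preceq> l"
    and "x \<in> Arr C" "Cod C x = fobj H l"
  shows "conn H j i \<cdot> (conn H l j \<cdot> x) = conn H l i \<cdot> x"
  using Cmp_eq_extend[OF conn_Cmp[OF sequence order]] assms by simp

lemma is_cone_Below_op_iff:
  "is_cone (Below_op j) C D x \<xi> \<longleftrightarrow> x \<in> Obj C \<and> (\<forall>i. i \<prec> j \<longrightarrow> \<guillemotleft>\<xi> i : x \<rightarrow> fobj D i\<guillemotright>) \<and>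
    (\<forall>i i'. i \<preceq> i' \<longrightarrow> i' \<prec> j \<longrightarrow> conn D i' i \<cdot> \<xi> i' = \<xi> i)"
proof -
  have "(\<forall>f \<in> Restr \<Omega> (underS j). farr D f \<cdot> \<xi> (snd f) = \<xi> (fst f)) \<longleftrightarrow>
      (\<forall>i i'. i \<preceq> i' \<longrightarrow> i' \<prec> j \<longrightarrow> conn D i' i \<cdot> \<xi> i' = \<xi> i)"
    by (simp add: Ball_def) (use le_less_trans in blast)
  then show ?thesis by (simp add: is_cone_def Ball_def)
qed

end

locale final_sequence = category_with_order C \<Omega>
  for C :: "('o, 'm) cat" (structure) and \<Omega> :: "'u rel" +
  fixes B :: "('o, 'm, 'o, 'm) fctr" and S :: "('u, 'u \<times> 'u, 'o, 'm) fctr"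
  assumes B_functor [simp]: "is_functor C C B" and final_seq: "is_final_sequence \<Omega> C B S"
begin

lemma S_functor [simp]: "is_functor (Ord_op \<Omega>) C S"
  using final_seq by (simp add: is_final_sequence_def)

lemma S_zero: "ord_zero \<Omega> i \<Longrightarrow> is_terminal C (fobj S i)"
  using final_seq by (simp add: is_final_sequence_def)

lemma S_succ [simp]: "i \<in> Field \<Omega> \<Longrightarrow> fobj S (succ i) = fobj B (fobj S i)"
  using final_seq by (simp add: is_final_sequence_def)

lemma conn_succ [simp]: "i \<preceq> j \<Longrightarrow> conn S (succ j) (succ i) = farr B (conn S j i)"
  using final_seq by (simp add: is_final_sequence_def)

lemma S_limit: "ord_limit \<Omega> j \<Longrightarrow> is_limit (Below_op j) C S (fobj S j) (\<lambda>i. conn S j i)"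
  using final_seq by (simp add: is_final_sequence_def)

lemma conn_from_succ:
  assumes "i \<in> Field \<Omega>"
  shows "conn S (succ i) i \<in> Arr C" "Dom C (conn S (succ i) i) = fobj B (fobj S i)"
    "Cod C (conn S (succ i) i) = fobj S i"
  using assms le_succ by simp_all

lemma conn_to_succ:
  assumes "i \<prec> j"
  shows "conn S j (succ i) \<in> Arr C" "Dom C (conn S j (succ i)) = fobj S j"
    "Cod C (conn S j (succ i)) = fobj B (fobj S i)"
  using assms succ_le underS_Field[OF assms] by simp_all

definition mediates :: "'u \<Rightarrow> 'o \<Rightarrow> ('u \<Rightarrow> 'm) \<Rightarrow> 'm \<Rightarrow> bool" where
  "mediates j x \<xi> h \<longleftrightarrow> \<guillemotleft>h : x \<rightarrow> fobj S j\<guillemotright> \<and> (\<forall>i. i \<prec> j \<longrightarrow> conn S j (succ i) \<cdot> h = \<xi> i)"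

lemma projected_cone:
  assumes cone: "is_cone (Below_op j) C (B \<circ>\<^sub>F S) x \<xi>"
  shows "is_cone (Below_op j) C S x (\<lambda>i. conn S (succ i) i \<cdot> \<xi> i)"
  unfolding is_cone_Below_op_iff
proof (intro conjI allI impI)
  have components: "\<guillemotleft>\<xi> i : x \<rightarrow> fobj B (fobj S i)\<guillemotright>" if "i \<prec> j" for i
    using cone that by (simp add: is_cone_Below_op_iff)
  show "x \<in> Obj C"
    using cone by (simp add: is_cone_Below_op_iff)
  show "\<guillemotleft>conn S (succ i) i \<cdot> \<xi> i : x \<rightarrow> fobj S i\<guillemotright>" if "i \<prec> j" for i
    using components[OF that] conn_from_succ[OF underS_Field[OF that]] by simp
  fix i i' assume i_le_i': "i \<preceq> i'" and i'_less_j: "i' \<prec> j"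
  have in_Field: "i \<in> Field \<Omega>" "i' \<in> Field \<Omega>" using le_Field[OF i_le_i'] .
  note [simp] = in_Field i_le_i' components[OF i'_less_j, simplified] conn_Cmp_extend[OF S_functor]
    le_succ[OF in_Field(1)] le_succ[OF in_Field(2)] succ_mono[OF i_le_i']
  have "conn S i' i \<cdot> (conn S (succ i') i' \<cdot> \<xi> i')
      = conn S (succ i) i \<cdot> (conn S (succ i') (succ i) \<cdot> \<xi> i')"
    by (simp del: conn_succ)
  also have "conn S (succ i') (succ i) \<cdot> \<xi> i' = \<xi> i"
    using cone i'_less_j by (simp add: is_cone_Below_op_iff)
  finally show "conn S i' i \<cdot> (conn S (succ i') i' \<cdot> \<xi> i') = conn S (succ i) i \<cdot> \<xi> i" .
qed

lemma limit_stage_mediates_iff: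
  assumes limit: "ord_limit \<Omega> j" and cone: "is_cone (Below_op j) C (B \<circ>\<^sub>F S) x \<xi>"
  shows "mediates j x \<xi> h \<longleftrightarrow>
    \<guillemotleft>h : x \<rightarrow> fobj S j\<guillemotright> \<and> (\<forall>i. i \<prec> j \<longrightarrow> conn S j i \<cdot> h = conn S (succ i) i \<cdot> \<xi> i)"
    (is "_ \<longleftrightarrow> ?hom \<and> ?projections")
proof (intro iffI conjI allI impI)
  assume mediates: "mediates j x \<xi> h"
  then show ?hom by (simp add: mediates_def)
  fix i assume i_less_j: "i \<prec> j"
  have "conn S j i \<cdot> h = conn S (succ i) i \<cdot> (conn S j (succ i) \<cdot> h)"
    using \<open>?hom\<close> underS_Field[OF i_less_j]
    by (intro conn_Cmp_extend[symmetric] S_functor le_succ succ_le[OF i_less_j]) simp_all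
  also have "conn S j (succ i) \<cdot> h = \<xi> i"
    using mediates i_less_j by (simp add: mediates_def)
  finally show "conn S j i \<cdot> h = conn S (succ i) i \<cdot> \<xi> i" .
next
  assume hom_projections: "?hom \<and> ?projections"
  have "conn S j (succ i) \<cdot> h = \<xi> i" if i_less_j: "i \<prec> j" for i
  proof -
    note succ_less_j = succ_less_limit[OF limit i_less_j]
    have "conn S j (succ i) \<cdot> h = conn S (succ (succ i)) (succ i) \<cdot> \<xi> (succ i)"
      using hom_projections succ_less_j by blast
    also have "\<dots> = farr B (conn S (succ i) i) \<cdot> \<xi> (succ i)"
      using underS_Field[OF i_less_j] by (simp add: le_succ)
    also have "\<dots> = \<xi> i"
      using cone succ_less_j le_succ[OF underS_Field[OF i_less_j]]
      unfolding is_cone_Below_op_iff comp_fctr_simps by blast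
    finally show ?thesis .
  qed
  then show "mediates j x \<xi> h"
    using hom_projections by (simp add: mediates_def)
qed

lemma stage_universal:
  assumes j_Field: "j \<in> Field \<Omega>" and cone: "is_cone (Below_op j) C (B \<circ>\<^sub>F S) x \<xi>"
  shows "\<exists>!h. mediates j x \<xi> h"
  using j_Field
proof (cases rule: ord_cases)
  case zero
  then show ?thesis
    using S_zero[OF zero] cone by (simp add: mediates_def is_terminal_def is_cone_def ord_zero_def)
next
  case (succ m)
  have m_less_j: "m \<prec> j" using succ less_succ by simp
  have "mediates j x \<xi> h \<longleftrightarrow> h = \<xi> m" for h
  proof
    assume "mediates j x \<xi> h"
    then show "h = \<xi> m"
      using m_less_j succ j_Field by (auto simp: mediates_def)
  next
    assume "h = \<xi> m"
    then show "mediates j x \<xi> h"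
      using cone m_less_j succ by (simp add: mediates_def less_succ_iff is_cone_Below_op_iff)
  qed
  then show ?thesis by simp
next
  case limit
  then show ?thesis
    using S_limit[OF limit] projected_cone[OF cone]
    by (simp add: limit_stage_mediates_iff[OF limit cone] is_limit_def Ball_def)
qed

lemma stage_eqI:
  assumes j_Field: "j \<in> Field \<Omega>" and hom: "\<guillemotleft>f : x \<rightarrow> fobj S j\<guillemotright>" "\<guillemotleft>g : x \<rightarrow> fobj S j\<guillemotright>"
    and proj_eq: "\<And>i. i \<prec> j \<Longrightarrow> conn S j (succ i) \<cdot> f = conn S j (succ i) \<cdot> g"
  shows "f = g"
proof -
  have "farr B (conn S i' i) \<cdot> (conn S j (succ i') \<cdot> f) = conn S j (succ i) \<cdot> f"
    if "i \<preceq> i'" "i' \<prec> j" for i i'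
    using that conn_Cmp_extend[OF S_functor succ_mono succ_le, of i i' j f] hom by simp
  then have "is_cone (Below_op j) C (B \<circ>\<^sub>F S) x (\<lambda>i. conn S j (succ i) \<cdot> f)"
    using hom in_hom_Obj[OF hom(1)] by (simp add: is_cone_Below_op_iff conn_to_succ)
  from stage_universal[OF j_Field this] show ?thesis
    using hom proj_eq unfolding mediates_def by metis
qed

end

section \<open>Natural transformations by recursion along the final sequence\<close>

locale final_sequence_recursion = final_sequence C \<Omega> B S
  for C :: "('o, 'm) cat" (structure) and \<Omega> :: "'u rel" and B S +
  fixes H :: "('u, 'u \<times> 'u, 'o, 'm) fctr" and step :: "'u \<Rightarrow> 'm \<Rightarrow> 'm"
  assumes H_functor [simp]: "is_functor (Ord_op \<Omega>) C H"
    and step_in_hom: "\<And>i f. i \<in> Field \<Omega> \<Longrightarrow> \<guillemotleft>f : fobj H i \<rightarrow> fobj S i\<guillemotright>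
      \<Longrightarrow> \<guillemotleft>step i f : fobj H (succ i) \<rightarrow> fobj S (succ i)\<guillemotright>"
    and step_natural: "\<And>i j f g. i \<preceq> j \<Longrightarrow> \<guillemotleft>f : fobj H i \<rightarrow> fobj S i\<guillemotright>
      \<Longrightarrow> \<guillemotleft>g : fobj H j \<rightarrow> fobj S j\<guillemotright> \<Longrightarrow> conn S j i \<cdot> g = f \<cdot> conn H j i
      \<Longrightarrow> conn S (succ j) (succ i) \<cdot> step j g = step i f \<cdot> conn H (succ j) (succ i)"
begin

definition follows_step :: "('u \<Rightarrow> 'm) \<Rightarrow> 'u \<Rightarrow> 'm \<Rightarrow> bool" where
  "follows_step \<tau> j = mediates j (fobj H j) (\<lambda>i. step i (\<tau> i) \<cdot> conn H j (succ i))"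

lemma follows_step_iff:
  "follows_step \<tau> j h \<longleftrightarrow> \<guillemotleft>h : fobj H j \<rightarrow> fobj S j\<guillemotright> \<and>
    (\<forall>i. i \<prec> j \<longrightarrow> conn S j (succ i) \<cdot> h = step i (\<tau> i) \<cdot> conn H j (succ i))"
  by (simp add: follows_step_def mediates_def)

lemma step_follows_in_hom:
  assumes "i \<in> Field \<Omega>" "follows_step \<tau> i f"
  shows "\<guillemotleft>step i f : fobj H (succ i) \<rightarrow> fobj S (succ i)\<guillemotright>"
  using assms by (intro step_in_hom) (simp_all add: follows_step_iff)

definition rec :: "'u \<Rightarrow> 'm" where
  "rec = worec (\<lambda>\<tau> j. THE h. follows_step \<tau> j h)"

lemma rec_eq: "rec j = (THE h. follows_step rec j h)"
proof -
  have "adm_wo (\<lambda>\<tau> j. THE h. follows_step \<tau> j h)"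
    unfolding adm_wo_def
  proof (intro allI impI)
    fix \<tau> \<tau>' :: "'u \<Rightarrow> 'm" and j assume "\<forall>i \<in> underS j. \<tau> i = \<tau>' i"
    then have "follows_step \<tau> j = follows_step \<tau>' j" by (auto simp: follows_step_iff)
    then show "(THE h. follows_step \<tau> j h) = (THE h. follows_step \<tau>' j h)" by simp
  qed
  from fun_cong[OF worec_fixpoint[OF this], of j] show ?thesis by (simp add: rec_def)
qed

lemma rec_natural_at:
  assumes i_le_j: "i \<preceq> j" and rec_steps: "\<And>m. m \<preceq> j \<Longrightarrow> follows_step rec m (rec m)"
  shows "conn S j i \<cdot> rec j = rec i \<cdot> conn H j i"
proof (rule stage_eqI)
  show Field: "i \<in> Field \<Omega>" using le_Field[OF i_le_j] by blast
  have rec_i: "follows_step rec i (rec i)" and rec_j: "follows_step rec j (rec j)"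
    using rec_steps[OF i_le_j] rec_steps[OF le_refl] le_Field[OF i_le_j] by simp_all
  then show "\<guillemotleft>conn S j i \<cdot> rec j : fobj H j \<rightarrow> fobj S i\<guillemotright>"
    "\<guillemotleft>rec i \<cdot> conn H j i : fobj H j \<rightarrow> fobj S i\<guillemotright>"
    using i_le_j by (simp_all add: follows_step_iff)
  fix m assume m_less_i: "m \<prec> i"
  note m_less_j = less_le_trans[OF m_less_i i_le_j]
  have step_hom: "\<guillemotleft>step m (rec m) : fobj H (succ m) \<rightarrow> fobj S (succ m)\<guillemotright>"
    by (rule step_follows_in_hom[OF underS_Field[OF m_less_i] rec_steps[OF less_imp_le[OF m_less_j]]])
  have "conn S i (succ m) \<cdot> (conn S j i \<cdot> rec j) = conn S j (succ m) \<cdot> rec j"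
    using rec_j i_le_j m_less_i
    by (intro conn_Cmp_extend) (simp_all add: follows_step_iff succ_le)
  also have "\<dots> = step m (rec m) \<cdot> conn H j (succ m)"
    using rec_j m_less_j by (simp add: follows_step_iff)
  also have "\<dots> = (step m (rec m) \<cdot> conn H i (succ m)) \<cdot> conn H j i"
    using step_hom conn_Cmp[OF H_functor succ_le[OF m_less_i] i_le_j] i_le_j succ_le[OF m_less_i]
    by simp
  also have "\<dots> = (conn S i (succ m) \<cdot> rec i) \<cdot> conn H j i"
    using rec_i m_less_i by (simp add: follows_step_iff)
  also have "\<dots> = conn S i (succ m) \<cdot> (rec i \<cdot> conn H j i)"
    using rec_i i_le_j conn_to_succ[OF m_less_i] by (simp add: follows_step_iff)
  finally show "conn S i (succ m) \<cdot> (conn S j i \<cdot> rec j)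
      = conn S i (succ m) \<cdot> (rec i \<cdot> conn H j i)" .
qed

lemma rec_cone:
  assumes j_Field: "j \<in> Field \<Omega>" and rec_steps: "\<And>m. m \<prec> j \<Longrightarrow> follows_step rec m (rec m)"
  shows "is_cone (Below_op j) C (B \<circ>\<^sub>F S) (fobj H j) (\<lambda>i. step i (rec i) \<cdot> conn H j (succ i))"
  unfolding is_cone_Below_op_iff
proof (intro conjI allI impI)
  show "fobj H j \<in> Obj C" using j_Field by simp
  have step_hom: "\<guillemotleft>step i (rec i) : fobj H (succ i) \<rightarrow> fobj S (succ i)\<guillemotright>" if "i \<prec> j" for i
    by (rule step_follows_in_hom[OF underS_Field[OF that] rec_steps[OF that]])
  then show "\<guillemotleft>step i (rec i) \<cdot> conn H j (succ i) : fobj H j \<rightarrow> fobj (B \<circ>\<^sub>F S) i\<guillemotright>" if "i \<prec> j" for i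
    using that succ_le[OF that] underS_Field[OF that] by simp
  fix i i' assume i_le_i': "i \<preceq> i'" and i'_less_j: "i' \<prec> j"
  note i_less_j = le_less_trans[OF i_le_i' i'_less_j]
  have "conn S i' i \<cdot> rec i' = rec i \<cdot> conn H i' i"
    using i_le_i' by (rule rec_natural_at) (rule rec_steps[OF le_less_trans[OF _ i'_less_j]])
  then have "conn S (succ i') (succ i) \<cdot> step i' (rec i')
      = step i (rec i) \<cdot> conn H (succ i') (succ i)"
    using rec_steps[OF i'_less_j] rec_steps[OF i_less_j]
    by (intro step_natural i_le_i') (simp_all add: follows_step_iff)
  then have "farr B (conn S i' i) \<cdot> (step i' (rec i') \<cdot> conn H j (succ i'))
      = (step i (rec i) \<cdot> conn H (succ i') (succ i)) \<cdot> conn H j (succ i')"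
    using i_le_i' step_hom[OF i'_less_j] le_Field[OF i_le_i'] succ_le[OF i'_less_j]
    by (intro Cmp_eq_extend) simp_all
  also have "\<dots> = step i (rec i) \<cdot> conn H j (succ i)"
    using step_hom[OF i_less_j] succ_mono[OF i_le_i'] succ_le[OF i'_less_j]
      conn_Cmp[OF H_functor succ_mono[OF i_le_i'] succ_le[OF i'_less_j]] by simp
  finally show "conn (B \<circ>\<^sub>F S) i' i \<cdot> (step i' (rec i') \<cdot> conn H j (succ i'))
      = step i (rec i) \<cdot> conn H j (succ i)" by simp
qed

lemma rec_follows_step: "j \<in> Field \<Omega> \<Longrightarrow> follows_step rec j (rec j)"
proof (induction j rule: well_order_induct[case_names less])
  case (less j)
  have "follows_step rec i (rec i)" if "i \<prec> j" for i
    using less that underS_Field[OF that] by (simp add: underS_def)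
  from stage_universal[OF less.prems rec_cone[OF less.prems this]]
  have "\<exists>!h. follows_step rec j h" unfolding follows_step_def .
  then show ?case unfolding rec_eq[of j] by (rule theI')
qed

lemma rec_natural: "is_nat (Ord_op \<Omega>) C H S rec"
proof -
  have "conn S j i \<cdot> rec j = rec i \<cdot> conn H j i" if "i \<preceq> j" for i j
    using that by (rule rec_natural_at) (rule rec_follows_step[OF le_Field(1)])
  then show ?thesis
    using rec_follows_step by (auto simp: is_nat_def follows_step_iff)
qed

lemma rec_succ:
  assumes i_Field: "i \<in> Field \<Omega>"
  shows "rec (succ i) = step i (rec i)"
  using rec_follows_step[OF succ_Field[OF i_Field]] less_succ[OF i_Field] succ_Field[OF i_Field]
    step_follows_in_hom[OF i_Field rec_follows_step[OF i_Field]]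
  by (auto simp: follows_step_iff simp del: conn_succ S_succ)

end

section \<open>Stable final sequences\<close>

definition is_coalgebra_hom ::
  "('o, 'm) cat \<Rightarrow> ('o, 'm, 'o, 'm) fctr \<Rightarrow> 'o \<Rightarrow> 'm \<Rightarrow> 'o \<Rightarrow> 'm \<Rightarrow> 'm \<Rightarrow> bool" where
  "is_coalgebra_hom C B x \<xi> y \<upsilon> h \<longleftrightarrow> is_coalgebra C B x \<xi> \<and> is_coalgebra C B y \<upsilon> \<and>
     h \<in> Hom C x y \<and> Cmp C \<upsilon> h = Cmp C (farr B h) \<xi>"

lemma is_final_coalgebra_iff:
  "is_final_coalgebra C B z \<zeta> \<longleftrightarrow> is_coalgebra C B z \<zeta> \<and>
    (\<forall>x \<xi>. is_coalgebra C B x \<xi> \<longrightarrow> (\<exists>!h. is_coalgebra_hom C B x \<xi> z \<zeta> h))"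
  by (simp add: is_final_coalgebra_def is_coalgebra_hom_def cong: conj_cong imp_cong)

definition const_fctr :: "('o, 'm) cat \<Rightarrow> 'o \<Rightarrow> ('j, 'k, 'o, 'm) fctr" where
  "const_fctr C x = \<lparr>fobj = (\<lambda>_. x), farr = (\<lambda>_. Ide C x)\<rparr>"

lemma const_fctr_simps [simp]: "fobj (const_fctr C x) j = x" "farr (const_fctr C x) f = Ide C x"
  by (simp_all add: const_fctr_def)

lemma (in category) is_functor_const: "x \<in> Obj C \<Longrightarrow> is_functor J C (const_fctr C x)"
  by (simp add: is_functor_def)

locale stable_final_sequence = final_sequence C \<Omega> B S
  for C :: "('o, 'm) cat" (structure) and \<Omega> :: "'u rel" and B S +
  fixes k :: 'u
  assumes k_Field [simp]: "k \<in> Field \<Omega>" and iso: "is_iso C (conn S (succ k) k)"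
begin

abbreviation Z :: 'o where
  "Z \<equiv> fobj S k"

abbreviation \<zeta> :: 'm where
  "\<zeta> \<equiv> inv_arr C (conn S (succ k) k)"

lemma zeta_simps [simp]: "\<zeta> \<in> Arr C" "Dom C \<zeta> = Z" "Cod C \<zeta> = fobj B Z"
  and conn_zeta: "conn S (succ k) k \<cdot> \<zeta> = Ide C Z"
  and zeta_conn: "\<zeta> \<cdot> conn S (succ k) k = Ide C (fobj B Z)"
  using inverse_inv_arr[OF iso] conn_from_succ[OF k_Field] by (simp_all add: is_inverse_def)

lemma zeta_naturality:
  assumes sequence: "is_functor (Ord_op \<Omega>) C H" and nat: "is_nat (Ord_op \<Omega>) C H S \<tau>"
    and right_inverse: "\<guillemotleft>s : fobj H k \<rightarrow> fobj H (succ k)\<guillemotright>" "conn H (succ k) k \<cdot> s = Ide C (fobj H k)"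
  shows "\<zeta> \<cdot> \<tau> k = \<tau> (succ k) \<cdot> s"
proof -
  note [simp] = sequence nat_simps[OF nat] conn_from_succ succ_Field le_succ
  have "conn S (succ k) k \<cdot> (\<tau> (succ k) \<cdot> s) = (\<tau> k \<cdot> conn H (succ k) k) \<cdot> s"
    using naturality[OF nat, of "(k, succ k)"] right_inverse by (intro Cmp_eq_extend) simp_all
  also have "\<dots> = \<tau> k"
    using right_inverse by simp
  finally have "\<zeta> \<cdot> \<tau> k = \<zeta> \<cdot> (conn S (succ k) k \<cdot> (\<tau> (succ k) \<cdot> s))" by simp
  also have "\<dots> = \<tau> (succ k) \<cdot> s"
    using right_inverse Cmp_eq_extend[OF zeta_conn, of "\<tau> (succ k) \<cdot> s"] by simp
  finally show ?thesis .
qed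

lemma zeta_naturality_functor:
  assumes endofunctor: "is_functor C C G" and nat: "is_nat (Ord_op \<Omega>) C (G \<circ>\<^sub>F S) S \<tau>"
  shows "\<zeta> \<cdot> \<tau> k = \<tau> (succ k) \<cdot> farr G \<zeta>"
proof (rule zeta_naturality[OF is_functor_comp[OF S_functor endofunctor] nat])
  have "conn (G \<circ>\<^sub>F S) (succ k) k \<cdot> farr G \<zeta> = farr G (conn S (succ k) k \<cdot> \<zeta>)"
    using endofunctor conn_from_succ[OF k_Field] by simp
  then show "conn (G \<circ>\<^sub>F S) (succ k) k \<cdot> farr G \<zeta> = Ide C (fobj (G \<circ>\<^sub>F S) k)"
    using endofunctor by (simp add: conn_zeta)
qed (use endofunctor in simp)

lemma zeta_coalgebra: "is_coalgebra C B Z \<zeta>"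
  by (simp add: is_coalgebra_def)

lemma coalgebra_hom_ex:
  assumes coalgebra: "is_coalgebra C B x \<xi>"
  shows "\<exists>h. is_coalgebra_hom C B x \<xi> Z \<zeta> h"
proof -
  have x_Obj [simp]: "x \<in> Obj C"
    and [simp]: "\<xi> \<in> Arr C" "Dom C \<xi> = x" "Cod C \<xi> = fobj B x"
    using coalgebra by (auto simp: is_coalgebra_def)
  interpret final_sequence_recursion C \<Omega> B S "const_fctr C x" "\<lambda>_ f. farr B f \<cdot> \<xi>"
  proof
    show "is_functor (Ord_op \<Omega>) C (const_fctr C x)" by (rule is_functor_const[OF x_Obj])
    fix i j f g assume i_le_j: "i \<preceq> j" and f_hom: "\<guillemotleft>f : fobj (const_fctr C x) i \<rightarrow> fobj S i\<guillemotright>"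
      and g_hom: "\<guillemotleft>g : fobj (const_fctr C x) j \<rightarrow> fobj S j\<guillemotright>"
      and square: "conn S j i \<cdot> g = f \<cdot> conn (const_fctr C x) j i"
    have "farr B (conn S j i) \<cdot> farr B g = farr B f"
      using arg_cong[OF square, of "farr B"] i_le_j f_hom g_hom by simp
    then show "conn S (succ j) (succ i) \<cdot> (farr B g \<cdot> \<xi>)
        = (farr B f \<cdot> \<xi>) \<cdot> conn (const_fctr C x) (succ j) (succ i)"
      using i_le_j f_hom g_hom Cmp_eq_extend[of "farr B (conn S j i)" "farr B g" "farr B f" \<xi>]
      by simp
  qed simp
  have "\<zeta> \<cdot> rec k = rec (succ k) \<cdot> Ide C x"
    by (rule zeta_naturality[OF H_functor rec_natural]) simp_all
  also have "\<dots> = farr B (rec k) \<cdot> \<xi>"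
    using nat_simps[OF rec_natural, of k] by (simp add: rec_succ)
  finally have "is_coalgebra_hom C B x \<xi> Z \<zeta> (rec k)"
    using coalgebra zeta_coalgebra nat_simps[OF rec_natural, of k]
    by (simp add: is_coalgebra_hom_def)
  then show ?thesis ..
qed

lemma conn_coalgebra_hom:
  assumes hom: "is_coalgebra_hom C B x \<xi> Z \<zeta> h" and i_less_k: "i \<prec> k"
  shows "conn S k (succ i) \<cdot> h = farr B (conn S k i \<cdot> h) \<cdot> \<xi>"
proof -
  note [simp] = conn_from_succ conn_to_succ[OF i_less_k] less_imp_le[OF i_less_k]
  have typing: "\<guillemotleft>h : x \<rightarrow> Z\<guillemotright>" "\<guillemotleft>\<xi> : x \<rightarrow> fobj B x\<guillemotright>" and zeta_h: "\<zeta> \<cdot> h = farr B h \<cdot> \<xi>"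
    using hom by (simp_all add: is_coalgebra_hom_def is_coalgebra_def)
  have "conn S k (succ i) \<cdot> h = conn S k (succ i) \<cdot> (conn S (succ k) k \<cdot> (\<zeta> \<cdot> h))"
    using typing Cmp_eq_extend[OF conn_zeta, of h] by simp
  also have "\<dots> = conn S (succ k) (succ i) \<cdot> (\<zeta> \<cdot> h)"
    using typing by (intro conn_Cmp_extend S_functor succ_le[OF i_less_k] le_succ) simp_all
  also have "\<dots> = farr B (conn S k i \<cdot> h) \<cdot> \<xi>"
    using typing by (simp add: zeta_h)
  finally show ?thesis .
qed

lemma coalgebra_homs_agree_below:
  assumes hom: "is_coalgebra_hom C B x \<xi> Z \<zeta> h" "is_coalgebra_hom C B x \<xi> Z \<zeta> h'"
  shows "i \<preceq> k \<Longrightarrow> conn S k i \<cdot> h = conn S k i \<cdot> h'"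
proof (induction i rule: well_order_induct[case_names less])
  case (less i)
  have typing: "\<guillemotleft>h : x \<rightarrow> Z\<guillemotright>" "\<guillemotleft>h' : x \<rightarrow> Z\<guillemotright>"
    using hom by (simp_all add: is_coalgebra_hom_def)
  show ?case
  proof (rule stage_eqI)
    show "i \<in> Field \<Omega>" "\<guillemotleft>conn S k i \<cdot> h : x \<rightarrow> fobj S i\<guillemotright>" "\<guillemotleft>conn S k i \<cdot> h' : x \<rightarrow> fobj S i\<guillemotright>"
      using typing less.prems le_Field[OF less.prems] by simp_all
    fix m assume m_less_i: "m \<prec> i"
    note m_less_k = less_le_trans[OF m_less_i less.prems]
    have "conn S i (succ m) \<cdot> (conn S k i \<cdot> h) = conn S k (succ m) \<cdot> h"
      using typing less.prems by (intro conn_Cmp_extend[OF S_functor succ_le[OF m_less_i]]) simp_all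
    also have "\<dots> = farr B (conn S k m \<cdot> h) \<cdot> \<xi>"
      by (rule conn_coalgebra_hom[OF hom(1) m_less_k])
    also have "conn S k m \<cdot> h = conn S k m \<cdot> h'"
      using less.IH m_less_i less_imp_le[OF m_less_k] by (simp add: underS_def)
    also have "farr B (conn S k m \<cdot> h') \<cdot> \<xi> = conn S k (succ m) \<cdot> h'"
      by (rule conn_coalgebra_hom[OF hom(2) m_less_k, symmetric])
    also have "\<dots> = conn S i (succ m) \<cdot> (conn S k i \<cdot> h')"
      using typing less.prems
      by (intro conn_Cmp_extend[OF S_functor succ_le[OF m_less_i], symmetric]) simp_all
    finally show "conn S i (succ m) \<cdot> (conn S k i \<cdot> h) = conn S i (succ m) \<cdot> (conn S k i \<cdot> h')" .
  qed
qed

lemma coalgebra_hom_unique: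
  assumes "is_coalgebra_hom C B x \<xi> Z \<zeta> h" "is_coalgebra_hom C B x \<xi> Z \<zeta> h'"
  shows "h = h'"
  using coalgebra_homs_agree_below[OF assms le_refl[OF k_Field]] assms
  by (simp add: is_coalgebra_hom_def)

lemma final_coalgebra: "is_final_coalgebra C B Z \<zeta>"
  unfolding is_final_coalgebra_iff
  using zeta_coalgebra coalgebra_hom_ex coalgebra_hom_unique by (blast intro: ex_ex1I)

end

section \<open>The codensity monad as a distributive law\<close>

lemma (in category) dlaw_induced_of_final_coalgebra:
  assumes final: "is_final_coalgebra C B z \<zeta>" and G_functor: "is_functor C C G"
    and law: "is_nat C C (G \<circ>\<^sub>F B) (B \<circ>\<^sub>F G) \<rho>"
    and solution: "is_algebra C G z \<beta>" "dlaw_equation C B G \<rho> z \<zeta> \<beta>"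
  shows "dlaw_induced C B G \<rho> z \<zeta> \<beta>"
proof -
  have "is_coalgebra C B (fobj G z) (\<rho> z \<cdot> farr G \<zeta>)"
    using final G_functor nat_simps[OF law] by (simp add: is_final_coalgebra_def is_coalgebra_def)
  then have "\<exists>!h. \<guillemotleft>h : fobj G z \<rightarrow> z\<guillemotright> \<and> \<zeta> \<cdot> h = farr B h \<cdot> (\<rho> z \<cdot> farr G \<zeta>)"
    using final by (simp add: is_final_coalgebra_def)
  then show ?thesis
    using solution by (auto simp: dlaw_induced_def dlaw_equation_def is_algebra_def)
qed

lemma right_kan_extension_factor:
  assumes "is_right_kan_extension A D E K X R \<epsilon>" "is_functor D E H" "is_nat A E (H \<circ>\<^sub>F K) X \<alpha>"
  obtains \<tau> where "is_nat D E H R \<tau>" "\<And>a. a \<in> Obj A \<Longrightarrow> \<alpha> a = Cmp E (\<epsilon> a) (\<tau> (fobj K a))"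
  using assms unfolding is_right_kan_extension_def by blast

lemma (in final_sequence) nat_shift:
  assumes endofunctor: "is_functor C C G" and nat: "is_nat (Ord_op \<Omega>) C (G \<circ>\<^sub>F S) S \<tau>"
  shows "is_nat (Ord_op \<Omega>) C ((G \<circ>\<^sub>F B) \<circ>\<^sub>F S) (B \<circ>\<^sub>F S) (\<lambda>i. \<tau> (succ i))"
proof -
  have "farr B (conn S j i) \<cdot> \<tau> (succ j) = \<tau> (succ i) \<cdot> farr G (farr B (conn S j i))"
    if "i \<preceq> j" for i j
    using that naturality[OF nat, of "(succ i, succ j)"] succ_mono[OF that] by simp
  moreover have "is_functor (Ord_op \<Omega>) C ((G \<circ>\<^sub>F B) \<circ>\<^sub>F S)" "is_functor (Ord_op \<Omega>) C (B \<circ>\<^sub>F S)"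
    by (rule is_functor_comp[OF S_functor] is_functor_comp[OF B_functor] endofunctor B_functor)+
  ultimately show ?thesis
    using nat_simps[OF nat] succ_Field by (auto simp: is_nat_def)
qed

context stable_final_sequence
begin

lemma codensity_dlaw:
  assumes codensity: "is_codensity (Ord_op \<Omega>) C S R \<epsilon>"
    and preserves: "preserves_codensity (Ord_op \<Omega>) C B S R \<epsilon>"
  obtains \<rho> where "is_nat C C (R \<circ>\<^sub>F B) (B \<circ>\<^sub>F R) \<rho>" "dlaw_induced C B R \<rho> Z \<zeta> (\<epsilon> k)"
proof -
  have R_functor [simp]: "is_functor C C R" and counit: "is_nat (Ord_op \<Omega>) C (R \<circ>\<^sub>F S) S \<epsilon>"
    using codensity by (simp_all add: is_codensity_def is_right_kan_extension_def)
  obtain \<rho> where law: "is_nat C C (R \<circ>\<^sub>F B) (B \<circ>\<^sub>F R) \<rho>"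
    and counit_succ: "\<And>i. i \<in> Field \<Omega> \<Longrightarrow> \<epsilon> (succ i) = farr B (\<epsilon> i) \<cdot> \<rho> (fobj S i)"
    using right_kan_extension_factor[OF preserves[unfolded preserves_codensity_def]
        is_functor_comp[OF B_functor R_functor] nat_shift[OF R_functor counit]] by auto
  have "\<zeta> \<cdot> \<epsilon> k = \<epsilon> (succ k) \<cdot> farr R \<zeta>"
    by (rule zeta_naturality_functor[OF R_functor counit])
  also have "\<dots> = farr B (\<epsilon> k) \<cdot> (\<rho> Z \<cdot> farr R \<zeta>)"
    using nat_simps[OF law] nat_simps[OF counit] by (simp add: counit_succ)
  finally have "dlaw_equation C B R \<rho> Z \<zeta> (\<epsilon> k)"
    by (simp add: dlaw_equation_def)
  moreover have "is_algebra C R Z (\<epsilon> k)"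
    using nat_simps[OF counit] by (simp add: is_algebra_def)
  ultimately show thesis
    using that[OF law] dlaw_induced_of_final_coalgebra[OF final_coalgebra R_functor law] by blast
qed

lemma definable_by_dlaw_of_nat:
  assumes codensity: "is_codensity (Ord_op \<Omega>) C S R \<epsilon>"
    and preserves: "preserves_codensity (Ord_op \<Omega>) C B S R \<epsilon>"
    and endofunctor: "is_functor C C F" and nat: "is_nat (Ord_op \<Omega>) C (F \<circ>\<^sub>F S) S \<tau>"
  shows "definable_by_dlaw C B F Z \<zeta> (\<tau> k)"
proof -
  obtain \<rho> where "is_nat C C (R \<circ>\<^sub>F B) (B \<circ>\<^sub>F R) \<rho>" "dlaw_induced C B R \<rho> Z \<zeta> (\<epsilon> k)"
    using codensity_dlaw[OF codensity preserves] .
  moreover obtain \<kappa> where "is_nat C C F R \<kappa>" "\<And>i. i \<in> Field \<Omega> \<Longrightarrow> \<tau> i = \<epsilon> i \<cdot> \<kappa> (fobj S i)"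
    using right_kan_extension_factor[OF codensity[unfolded is_codensity_def] endofunctor nat]
    by auto
  moreover have "is_functor C C R"
    using codensity by (simp add: is_codensity_def is_right_kan_extension_def)
  ultimately show ?thesis
    unfolding definable_by_dlaw_def using k_Field by blast
qed

end

section \<open>Pairing into products\<close>

context category
begin

lemma pairing_simps:
  assumes product: "is_product C a b c p q"
    and span: "f \<in> Arr C" "g \<in> Arr C" "Dom C g = Dom C f" "Cod C f = a" "Cod C g = b"
  shows "pairing C p q f g \<in> Arr C" "Dom C (pairing C p q f g) = Dom C f"
    "Cod C (pairing C p q f g) = c" "p \<cdot> pairing C p q f g = f" "q \<cdot> pairing C p q f g = g"
proof -
  have "\<exists>!h. \<guillemotleft>h : Dom C f \<rightarrow> Dom C p\<guillemotright> \<and> p \<cdot> h = f \<and> q \<cdot> h = g"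
    using product span by (simp add: is_product_def)
  from theI'[OF this, folded pairing_def]
  show "pairing C p q f g \<in> Arr C" "Dom C (pairing C p q f g) = Dom C f"
    "Cod C (pairing C p q f g) = c" "p \<cdot> pairing C p q f g = f" "q \<cdot> pairing C p q f g = g"
    using product by (simp_all add: is_product_def)
qed

lemma pairing_eqI:
  assumes product: "is_product C a b c p q" and h_typing: "h \<in> Arr C" "Cod C h = c"
    and proj: "p \<cdot> h = f" "q \<cdot> h = g"
  shows "h = pairing C p q f g"
proof -
  have span: "f \<in> Arr C" "g \<in> Arr C" "Dom C f = Dom C h" "Dom C g = Dom C h"
    "Cod C f = a" "Cod C g = b"
    using product h_typing proj by (auto simp: is_product_def)
  then have "\<exists>!h'. \<guillemotleft>h' : Dom C h \<rightarrow> c\<guillemotright> \<and> p \<cdot> h' = f \<and> q \<cdot> h' = g"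
    using product h_typing by (simp add: is_product_def)
  then show ?thesis
    using h_typing proj span pairing_simps[OF product, of f g] by auto
qed

lemma pairing_Cmp:
  assumes product: "is_product C a b c p q"
    and span: "f \<in> Arr C" "g \<in> Arr C" "Dom C g = Dom C f" "Cod C f = a" "Cod C g = b"
    and h_typing: "h \<in> Arr C" "Cod C h = Dom C f"
  shows "pairing C p q f g \<cdot> h = pairing C p q (f \<cdot> h) (g \<cdot> h)"
proof (rule pairing_eqI[OF product])
  note [simp] = pairing_simps[OF product span]
  show "pairing C p q f g \<cdot> h \<in> Arr C" "Cod C (pairing C p q f g \<cdot> h) = c"
    using h_typing by simp_all
  show "p \<cdot> (pairing C p q f g \<cdot> h) = f \<cdot> h" "q \<cdot> (pairing C p q f g \<cdot> h) = g \<cdot> h"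
    using product h_typing by (auto intro!: Cmp_eq_extend simp: is_product_def)
qed

end

locale product_functor = category C for C :: "('o, 'm) cat" (structure) +
  fixes F\<^sub>1 F\<^sub>2 P :: "('o, 'm, 'o, 'm) fctr" and p q :: "'o \<Rightarrow> 'm"
  assumes product_fctr: "is_product_fctr C F\<^sub>1 F\<^sub>2 P p q"
begin

lemma product: "x \<in> Obj C \<Longrightarrow> is_product C (fobj F\<^sub>1 x) (fobj F\<^sub>2 x) (fobj P x) (p x) (q x)"
  and p_natural: "is_nat C C P F\<^sub>1 p" and q_natural: "is_nat C C P F\<^sub>2 q"
  using product_fctr by (auto simp: is_product_fctr_def)

lemma P_functor: "is_functor C C P"
  using p_natural by (rule is_nat_functors)

abbreviation pair :: "'o \<Rightarrow> 'm \<Rightarrow> 'm \<Rightarrow> 'm" where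
  "pair x f g \<equiv> pairing C (p x) (q x) f g"

lemmas pair_simps [simp] = pairing_simps[OF product]

lemmas pair_Cmp = pairing_Cmp[OF product]

lemma map_pair:
  assumes span: "f \<in> Arr C" "g \<in> Arr C" "Dom C g = Dom C f"
      "Cod C f = fobj F\<^sub>1 x" "Cod C g = fobj F\<^sub>2 x"
    and h_hom: "\<guillemotleft>h : x \<rightarrow> y\<guillemotright>"
  shows "farr P h \<cdot> pair x f g = pair y (farr F\<^sub>1 h \<cdot> f) (farr F\<^sub>2 h \<cdot> g)"
proof (rule pairing_eqI[OF product])
  note [simp] = in_hom_Obj[OF h_hom] is_nat_functors[OF p_natural] is_nat_functors[OF q_natural]
    nat_simps[OF p_natural] nat_simps[OF q_natural]
  show "y \<in> Obj C" by simp
  show "farr P h \<cdot> pair x f g \<in> Arr C" "Cod C (farr P h \<cdot> pair x f g) = fobj P y"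
    using span h_hom by simp_all
  show "p y \<cdot> (farr P h \<cdot> pair x f g) = farr F\<^sub>1 h \<cdot> f"
    using span h_hom naturality_extend[OF p_natural, of h x "pair x f g"] by simp
  show "q y \<cdot> (farr P h \<cdot> pair x f g) = farr F\<^sub>2 h \<cdot> g"
    using span h_hom naturality_extend[OF q_natural, of h x "pair x f g"] by simp
qed

end

section \<open>Interpreting a GSOS specification along the final sequence\<close>

locale gsos_specification = final_sequence C \<Omega> B S + free_monad C F T \<eta> \<mu> \<iota> +
    product_functor C B id_fctr P p q
  for C :: "('o, 'm) cat" (structure) and \<Omega> :: "'u rel" and B S F T \<eta> \<mu> \<iota> P p q +
  fixes l :: "'o \<Rightarrow> 'm"
  assumes l_natural: "is_nat C C (F \<circ>\<^sub>F P) (B \<circ>\<^sub>F T) l"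
begin

lemmas [simp] = P_functor nat_simps[OF l_natural, simplified]

definition stage_pair :: "'u \<Rightarrow> 'm" where
  "stage_pair i = pair (fobj S i) (Ide C (fobj B (fobj S i))) (conn S (succ i) i)"

definition gsos_step :: "'u \<Rightarrow> 'm \<Rightarrow> 'm" where
  "gsos_step i a = farr B (ext (fobj S i) a) \<cdot> (l (fobj S i) \<cdot> farr F (stage_pair i))"

lemma stage_pair_simps [simp]:
  assumes "i \<in> Field \<Omega>"
  shows "stage_pair i \<in> Arr C" "Dom C (stage_pair i) = fobj B (fobj S i)"
    "Cod C (stage_pair i) = fobj P (fobj S i)"
  using assms conn_from_succ[OF assms] by (simp_all add: stage_pair_def)

lemma stage_pair_natural:
  assumes i_le_j: "i \<preceq> j"
  shows "farr P (conn S j i) \<cdot> stage_pair j = stage_pair i \<cdot> farr B (conn S j i)"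
proof -
  have in_Field: "i \<in> Field \<Omega>" "j \<in> Field \<Omega>" using le_Field[OF i_le_j] .
  note [simp] = in_Field i_le_j conn_from_succ
  have "conn S j i \<cdot> conn S (succ j) j = conn S (succ i) i \<cdot> conn S (succ j) (succ i)"
    using conn_Cmp[OF S_functor i_le_j le_succ] conn_Cmp[OF S_functor le_succ succ_mono[OF i_le_j]]
    by simp
  then have "farr P (conn S j i) \<cdot> stage_pair j
      = pair (fobj S i) (farr B (conn S j i)) (conn S (succ i) i \<cdot> farr B (conn S j i))"
    unfolding stage_pair_def by (subst map_pair) simp_all
  also have "\<dots> = stage_pair i \<cdot> farr B (conn S j i)"
    by (simp add: stage_pair_def pair_Cmp)
  finally show ?thesis .
qed

lemma gsos_step_in_hom:
  assumes "i \<in> Field \<Omega>" "\<guillemotleft>a : fobj F (fobj S i) \<rightarrow> fobj S i\<guillemotright>"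
  shows "\<guillemotleft>gsos_step i a : fobj F (fobj S (succ i)) \<rightarrow> fobj S (succ i)\<guillemotright>"
  using assms ext_in_hom[OF assms(2)] by (simp add: gsos_step_def)

lemma gsos_step_natural:
  assumes i_le_j: "i \<preceq> j" and a_hom: "\<guillemotleft>a : fobj F (fobj S i) \<rightarrow> fobj S i\<guillemotright>"
    and b_hom: "\<guillemotleft>b : fobj F (fobj S j) \<rightarrow> fobj S j\<guillemotright>"
    and a_b_square: "conn S j i \<cdot> b = a \<cdot> farr F (conn S j i)"
  shows "farr B (conn S j i) \<cdot> gsos_step j b = gsos_step i a \<cdot> farr F (farr B (conn S j i))"
proof -
  let ?c = "conn S j i" and ?x = "fobj S i" and ?y = "fobj S j"
  have in_Field: "i \<in> Field \<Omega>" "j \<in> Field \<Omega>" using le_Field[OF i_le_j] .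
  note [simp] = in_Field i_le_j ext_in_hom[OF a_hom, simplified] ext_in_hom[OF b_hom, simplified]
  have ext_square: "farr B ?c \<cdot> farr B (ext ?y b) = farr B (ext ?x a) \<cdot> farr B (farr T ?c)"
  proof -
    have "is_algebra_hom C F ?y b ?x a ?c"
      using a_hom b_hom a_b_square by (simp add: is_algebra_hom_def is_algebra_def)
    from arg_cong[OF ext_natural[OF this], of "farr B"] show ?thesis by simp
  qed
  have pair_square: "farr F (farr P ?c) \<cdot> farr F (stage_pair j)
      = farr F (stage_pair i) \<cdot> farr F (farr B ?c)"
    using arg_cong[OF stage_pair_natural[OF i_le_j], of "farr F"] by simp
  have "farr B ?c \<cdot> gsos_step j b
      = farr B (ext ?x a) \<cdot> (farr B (farr T ?c) \<cdot> (l ?y \<cdot> farr F (stage_pair j)))"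
    using Cmp_eq_extend[OF ext_square, of "l ?y \<cdot> farr F (stage_pair j)"]
    by (simp add: gsos_step_def)
  also have "farr B (farr T ?c) \<cdot> (l ?y \<cdot> farr F (stage_pair j))
      = l ?x \<cdot> (farr F (farr P ?c) \<cdot> farr F (stage_pair j))"
    using naturality_extend[OF l_natural, of ?c ?y "farr F (stage_pair j)"] by simp
  also have "farr B (ext ?x a) \<cdot> \<dots> = gsos_step i a \<cdot> farr F (farr B ?c)"
    unfolding pair_square by (simp add: gsos_step_def)
  finally show ?thesis .
qed

sublocale stage_algebra: final_sequence_recursion C \<Omega> B S "F \<circ>\<^sub>F S" gsos_step
proof
  show "is_functor (Ord_op \<Omega>) C (F \<circ>\<^sub>F S)" by (rule is_functor_comp[OF S_functor F_functor])
  show "\<guillemotleft>gsos_step i f : fobj (F \<circ>\<^sub>F S) (succ i) \<rightarrow> fobj S (succ i)\<guillemotright>"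
    if "i \<in> Field \<Omega>" "\<guillemotleft>f : fobj (F \<circ>\<^sub>F S) i \<rightarrow> fobj S i\<guillemotright>" for i f
    using gsos_step_in_hom[of i f] that by (simp only: comp_fctr_simps)
  show "conn S (succ j) (succ i) \<cdot> gsos_step j g = gsos_step i f \<cdot> conn (F \<circ>\<^sub>F S) (succ j) (succ i)"
    if "i \<preceq> j" "\<guillemotleft>f : fobj (F \<circ>\<^sub>F S) i \<rightarrow> fobj S i\<guillemotright>" "\<guillemotleft>g : fobj (F \<circ>\<^sub>F S) j \<rightarrow> fobj S j\<guillemotright>"
      "conn S j i \<cdot> g = f \<cdot> conn (F \<circ>\<^sub>F S) j i" for i j f g
    using gsos_step_natural[of i j f g] that by simp
qed

end

locale stable_gsos_specification = gsos_specification C \<Omega> B S F T \<eta> \<mu> \<iota> P p q l +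
    stable_final_sequence C \<Omega> B S k
  for C :: "('o, 'm) cat" (structure) and \<Omega> :: "'u rel" and B S F T \<eta> \<mu> \<iota> P p q l k
begin

lemma stage_pair_zeta: "stage_pair k \<cdot> \<zeta> = pair Z \<zeta> (Ide C Z)"
  by (simp add: stage_pair_def pair_Cmp conn_from_succ conn_zeta)

lemma stage_algebra_in_hom: "\<guillemotleft>stage_algebra.rec k : fobj F Z \<rightarrow> Z\<guillemotright>"
  using nat_simps[OF stage_algebra.rec_natural, of k] by simp

lemma gsos_equation_stage_algebra:
  "gsos_equation C B F T \<eta> \<mu> \<iota> p q l Z \<zeta> (stage_algebra.rec k)"
proof -
  note [simp] = stage_algebra_in_hom[simplified] ext_in_hom[OF stage_algebra_in_hom, simplified]
  have "\<zeta> \<cdot> stage_algebra.rec k = gsos_step k (stage_algebra.rec k) \<cdot> farr F \<zeta>"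
    using zeta_naturality_functor[OF F_functor stage_algebra.rec_natural]
    by (simp add: stage_algebra.rec_succ)
  also have "\<dots> = farr B (ext Z (stage_algebra.rec k)) \<cdot> (l Z \<cdot> farr F (stage_pair k \<cdot> \<zeta>))"
    by (simp add: gsos_step_def)
  finally show ?thesis
    unfolding gsos_equation_def stage_pair_zeta .
qed

lemma gsos_induced_definable_by_dlaw:
  assumes "is_codensity (Ord_op \<Omega>) C S R \<epsilon>" "preserves_codensity (Ord_op \<Omega>) C B S R \<epsilon>"
    and induced: "gsos_induced C B F T \<eta> \<mu> \<iota> p q l Z \<zeta> \<alpha>"
  shows "definable_by_dlaw C B F Z \<zeta> \<alpha>"
proof -
  have "is_algebra C F Z (stage_algebra.rec k)"
    using stage_algebra_in_hom by (simp add: is_algebra_def)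
  then have "stage_algebra.rec k = \<alpha>"
    using induced gsos_equation_stage_algebra by (simp add: gsos_induced_def)
  then show ?thesis
    using definable_by_dlaw_of_nat[OF assms(1,2) F_functor stage_algebra.rec_natural] by simp
qed

end

theorem theorem10p2:
  fixes C :: "('o, 'm) cat" and \<Omega> :: "'u rel"
    and B F T P R :: "('o, 'm, 'o, 'm) fctr"
    and S :: "('u, 'u \<times> 'u, 'o, 'm) fctr"
    and \<epsilon> :: "'u \<Rightarrow> 'm" and \<eta> \<mu> \<iota> p q :: "'o \<Rightarrow> 'm" and k :: 'u
  assumes "universe_size \<Omega>"
    and "complete_category \<Omega> C"
    and "is_functor C C B"
    and "is_final_sequence \<Omega> C B S"
    and "is_codensity (Ord_op \<Omega>) C S R \<epsilon>"
    and "preserves_codensity (Ord_op \<Omega>) C B S R \<epsilon>"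
    and "k \<in> Field \<Omega>"
    and "is_iso C (conn S (ord_suc \<Omega> k) k)"
    and "is_functor C C F"
    and "is_free_monad C F T \<eta> \<mu> \<iota>"
    and "is_product_fctr C B id_fctr P p q"
  shows "is_final_coalgebra C B (fobj S k) (inv_arr C (conn S (ord_suc \<Omega> k) k)) \<and>
    (\<forall>l \<alpha>. is_nat C C (F \<circ>\<^sub>F P) (B \<circ>\<^sub>F T) l \<longrightarrow>
      gsos_induced C B F T \<eta> \<mu> \<iota> p q l (fobj S k) (inv_arr C (conn S (ord_suc \<Omega> k) k)) \<alpha> \<longrightarrow>
      definable_by_dlaw C B F (fobj S k) (inv_arr C (conn S (ord_suc \<Omega> k) k)) \<alpha>)"
proof -
  interpret category C
    using assms(2) by (simp add: complete_category_def)
  interpret unbounded_wo_rel \<Omega>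
    using assms(1) by (rule unbounded_wo_rel_universe)
  interpret stable_final_sequence C \<Omega> B S k
    using assms by unfold_locales
  have "definable_by_dlaw C B F Z \<zeta> \<alpha>"
    if "is_nat C C (F \<circ>\<^sub>F P) (B \<circ>\<^sub>F T) l" "gsos_induced C B F T \<eta> \<mu> \<iota> p q l Z \<zeta> \<alpha>" for l \<alpha>
  proof -
    interpret stable_gsos_specification C \<Omega> B S F T \<eta> \<mu> \<iota> P p q l k
      using assms that by unfold_locales
    show ?thesis using assms(5,6) that(2) by (rule gsos_induced_definable_by_dlaw)
  qed
  then show ?thesis using final_coalgebra by blast
qed

end
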